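(* Let $d,n\in\mathbb{N}$ and let $U\subseteq\mathbb{R}^d$ be a set of $n$ points. Then $D(\mathsf{CSD}_U)=O(d^2\log d\log n)$.
   Context: $\mathsf{CSD}_U:2^U\times 2^U\to\{0,1\}$ is the Convex Set Disjointness function: Alice holds $X\subseteq U$, Bob holds $Y\subseteq U$, and $\mathsf{CSD}_U(X,Y)=0$ if $\mathrm{conv}(X)\cap\mathrm{conv}(Y)\neq\emptyset$ and $1$ otherwise, where $\mathrm{conv}$ denotes convex hull. $D(f)$ denotes the deterministic two-party communication complexity of $f$. *)

theory Defs
  imports "HOL-Analysis.Analysis" "HOL-Analysis.Finite_Function_Topology"
begin

text \<open>Real d-space for a variable d, as a subspace of one fixed real vector space of finitely
  supported sequences. Having all dimensions inside a single type lets a statement quantify over d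
  (and so place a constant before that quantifier) while \<open>convex hull\<close> remains the library
  operator; the subspace is closed under it.\<close>

definition real_space :: "nat \<Rightarrow> (nat \<Rightarrow>\<^sub>0 real) set" where
  "real_space d = {x. Poly_Mapping.keys x \<subseteq> {..<d}}"

text \<open>Deterministic two-party protocol trees. At an inner node the named player sends one bit,
  which depends on that player's own input and on the node only; bit \<open>True\<close> moves to the first
  subtree. A leaf is labelled with the common output.\<close>

datatype ('a, 'b, 'o) protocol =
    Output 'o
  | Alice_Speaks "'a \<Rightarrow> bool" "('a, 'b, 'o) protocol" "('a, 'b, 'o) protocol"
  | Bob_Speaks "'b \<Rightarrow> bool" "('a, 'b, 'o) protocol" "('a, 'b, 'o) protocol"

primrec run_protocol :: "('a, 'b, 'o) protocol \<Rightarrow> 'a \<Rightarrow> 'b \<Rightarrow> 'o" where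
  "run_protocol (Output z) x y = z"
| "run_protocol (Alice_Speaks h p q) x y = (if h x then run_protocol p x y else run_protocol q x y)"
| "run_protocol (Bob_Speaks h p q) x y = (if h y then run_protocol p x y else run_protocol q x y)"

primrec protocol_cost :: "('a, 'b, 'o) protocol \<Rightarrow> nat" where
  "protocol_cost (Output z) = 0"
| "protocol_cost (Alice_Speaks h p q) = Suc (max (protocol_cost p) (protocol_cost q))"
| "protocol_cost (Bob_Speaks h p q) = Suc (max (protocol_cost p) (protocol_cost q))"

definition protocol_computes ::
    "('a, 'b, 'o) protocol \<Rightarrow> 'a set \<Rightarrow> 'b set \<Rightarrow> ('a \<Rightarrow> 'b \<Rightarrow> 'o) \<Rightarrow> bool" where
  "protocol_computes p A B f \<longleftrightarrow> (\<forall>x\<in>A. \<forall>y\<in>B. run_protocol p x y = f x y)"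

text \<open>D(f) for a function f on \<open>A \<times> B\<close>. The value is \<open>\<infinity>\<close> (not 0) if no protocol computes f.\<close>

definition det_comm_complexity :: "'a set \<Rightarrow> 'b set \<Rightarrow> ('a \<Rightarrow> 'b \<Rightarrow> 'o) \<Rightarrow> enat" where
  "det_comm_complexity A B f = (INF p\<in>{p. protocol_computes p A B f}. enat (protocol_cost p))"

definition convex_set_disjointness :: "'v::real_vector set \<Rightarrow> 'v set \<Rightarrow> nat" where
  "convex_set_disjointness X Y = (if (convex hull X) \<inter> (convex hull Y) \<noteq> {} then 0 else 1)"

text \<open>The function is indexed by its ground set only through its domain, which consists of the
  pairs of subsets of U.\<close>

definition csd_complexity :: "'v::real_vector set \<Rightarrow> enat" where
  "csd_complexity U = det_comm_complexity (Pow U) (Pow U) convex_set_disjointness"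

text \<open>The logarithms in the bound vanish at argument 1, where the complexity itself is nonzero
  (for d = 1, or for a single point). They are read as at least 1; nothing
  changes for arguments at least 2.\<close>

definition log_ge1 :: "nat \<Rightarrow> real" where
  "log_ge1 m = max 1 (log 2 (real m))"

end

theory Submission
  imports Defs
begin

text \<open>If the hulls of \<open>X\<close> and \<open>Y\<close> meet, they meet in one of at most \<open>(n + 1)^(2d + 2)\<close> witness
  points, by Caratheodory's theorem. The players maintain a set \<open>V\<close> of witnesses that contains every
  remaining candidate for a common point. If the hulls are disjoint, one side of a separating hyperplane
  contains at most half of \<open>V\<close>, so one player owns a halfspace that contains the player's own set and at
  most half of \<open>V\<close>. This player announces a container: a set of at most three quarters of \<open>V\<close> that
  covers the halfspace, taken from a family of \<open>d^O(d)\<close> sets. If neither player owns such a halfspace,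
  the hulls meet. There are \<open>O(d log n)\<close> rounds of \<open>O(d log d)\<close> bits.

  Containers: after homogenization a halfspace is a linear functional \<open>f\<close>. Take a random sample \<open>N\<close> of
  size \<open>O(d^4)\<close>, consider the cell of \<open>f\<close> in the arrangement of the hyperplanes dual to \<open>N\<close>, and write
  \<open>f\<close> as a nonnegative combination of at most \<open>d + 1\<close> extreme rays of this cell. The container is the
  union of the halfspaces of these rays. Each ray is determined by few points of \<open>N\<close>, and no point of
  \<open>N\<close> is separated by two rays of a common cell, so by sampling few points of \<open>V\<close> are.\<close>

section \<open>Counting\<close>

lemma bounded_lists:
  fixes S :: "'a set"
  assumes "finite S"
  shows "finite {xs. set xs \<subseteq> S \<and> length xs \<le> k} \<and>
    card {xs. set xs \<subseteq> S \<and> length xs \<le> k} \<le> (card S + 1) ^ k"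
proof (induction k)
  case 0
  have "{xs. set xs \<subseteq> S \<and> length xs \<le> 0} = {[]}" by auto
  then show ?case by simp
next
  case (Suc k)
  let ?L = "\<lambda>k. {xs. set xs \<subseteq> S \<and> length xs \<le> k}"
  have eq: "?L (Suc k) = insert [] ((\<lambda>(x, xs). x # xs) ` (S \<times> ?L k))"
  proof (intro set_eqI iffI)
    fix xs assume "xs \<in> ?L (Suc k)"
    then show "xs \<in> insert [] ((\<lambda>(x, xs). x # xs) ` (S \<times> ?L k))"
      by (cases xs) auto
  qed auto
  have fin: "finite (S \<times> ?L k)" using assms Suc by blast
  have "card (?L (Suc k)) \<le> Suc (card ((\<lambda>(x, xs). x # xs) ` (S \<times> ?L k)))"
    unfolding eq by (rule card_insert_le_m1) auto
  also have "\<dots> \<le> Suc (card (S \<times> ?L k))" using card_image_le[OF fin] by simp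
  also have "\<dots> \<le> Suc (card S * (card S + 1) ^ k)"
    using Suc by (simp add: card_cartesian_product)
  also have "\<dots> \<le> (card S + 1) ^ Suc k"
    using one_le_power[of "card S + 1" k] by simp
  finally show ?case unfolding eq using fin by simp
qed

text \<open>A subset of size at most \<open>k\<close> is the set of a distinct list of the same
  length, so the count of lists applies.\<close>

lemma bounded_subsets:
  fixes S :: "'a set"
  assumes "finite S"
  shows "card {I. I \<subseteq> S \<and> card I \<le> k} \<le> (card S + 1) ^ k"
proof -
  let ?L = "{xs. set xs \<subseteq> S \<and> length xs \<le> k}"
  have "{I. I \<subseteq> S \<and> card I \<le> k} \<subseteq> set ` ?L"
  proof
    fix I assume I: "I \<in> {I. I \<subseteq> S \<and> card I \<le> k}"
    then have "finite I" using assms finite_subset by blast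
    then obtain xs where "set xs = I" "distinct xs" using finite_distinct_list by blast
    then show "I \<in> set ` ?L" using I distinct_card by fastforce
  qed
  then have "card {I. I \<subseteq> S \<and> card I \<le> k} \<le> card ?L"
    by (rule surj_card_le[rotated]) (use bounded_lists[OF assms, of k] in blast)
  then show ?thesis using bounded_lists[OF assms, of k] by linarith
qed

section \<open>Shattering and the number of halfspace traces\<close>

definition shattered :: "'a set set \<Rightarrow> 'a set \<Rightarrow> bool" where
  "shattered F A \<longleftrightarrow> (\<forall>B\<subseteq>A. \<exists>X\<in>F. X \<inter> A = B)"

text \<open>Pajor's form of the Sauer-Shelah lemma.\<close>

lemma card_le_card_shattered:
  assumes "finite S" "F \<subseteq> Pow S"
  shows "card F \<le> card {A. A \<subseteq> S \<and> shattered F A}"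
  using assms
proof (induction S arbitrary: F rule: finite_induct)
  case empty
  show ?case
  proof (cases "F = {}")
    case False
    then have "F = {{}}" using empty by (metis Pow_empty subset_singletonD)
    moreover have "shattered {{}} ({}::'a set)" by (simp add: shattered_def)
    ultimately have "{A. A \<subseteq> {} \<and> shattered F A} = {{}}" by auto
    then show ?thesis using \<open>F = {{}}\<close> by simp
  qed simp
next
  case (insert x S)
  \<comment> \<open>Split by membership of \<open>x\<close>. A set in \<open>F0 \<inter> F1\<close>
    extends to a member of \<open>F\<close> both with and without \<open>x\<close>, so a set
    \<open>A\<close> shattered by \<open>F0 \<inter> F1\<close> makes \<open>insert x A\<close>
    shattered by \<open>F\<close>.\<close>
  define F0 where "F0 = {X \<in> F. x \<notin> X}"
  define F1 where "F1 = (\<lambda>X. X - {x}) ` {X \<in> F. x \<in> X}"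
  have finF: "finite F" using insert.prems insert.hyps(1) finite_subset[of F "Pow (insert x S)"] by simp
  have sub: "F0 \<subseteq> Pow S" "F1 \<subseteq> Pow S" using insert.prems unfolding F0_def F1_def by auto
  then have fin: "finite F0" "finite F1" using insert.hyps(1) finite_subset[of _ "Pow S"] by simp_all
  have "card F1 = card {X \<in> F. x \<in> X}"
    unfolding F1_def by (rule card_image) (auto simp: inj_on_def)
  moreover have "card F = card F0 + card {X \<in> F. x \<in> X}"
  proof -
    have "card (F0 \<union> {X \<in> F. x \<in> X}) = card F0 + card {X \<in> F. x \<in> X}"
      by (rule card_Un_disjoint) (use finF in \<open>auto simp: F0_def\<close>)
    moreover have "F0 \<union> {X \<in> F. x \<in> X} = F" unfolding F0_def by auto
    ultimately show ?thesis by simp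
  qed
  ultimately have "card F = card (F0 \<union> F1) + card (F0 \<inter> F1)"
    using card_Un_Int[OF fin] by simp
  also have "\<dots> \<le> card {A. A \<subseteq> S \<and> shattered (F0 \<union> F1) A} + card {A. A \<subseteq> S \<and> shattered (F0 \<inter> F1) A}"
    by (intro add_mono insert.IH) (use sub in auto)
  also have "\<dots> = card {A. A \<subseteq> S \<and> shattered (F0 \<union> F1) A} +
      card (insert x ` {A. A \<subseteq> S \<and> shattered (F0 \<inter> F1) A})"
  proof -
    have "inj_on (insert x) {A. A \<subseteq> S \<and> shattered (F0 \<inter> F1) A}"
      using insert.hyps(2) by (auto simp: inj_on_def)
    then show ?thesis by (simp add: card_image)
  qed
  also have "\<dots> = card ({A. A \<subseteq> S \<and> shattered (F0 \<union> F1) A} \<union>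
      insert x ` {A. A \<subseteq> S \<and> shattered (F0 \<inter> F1) A})"
  proof (rule card_Un_disjoint[symmetric])
    show "finite {A. A \<subseteq> S \<and> shattered (F0 \<union> F1) A}" using insert.hyps(1) by simp
    show "finite (insert x ` {A. A \<subseteq> S \<and> shattered (F0 \<inter> F1) A})" using insert.hyps(1) by simp
    show "{A. A \<subseteq> S \<and> shattered (F0 \<union> F1) A} \<inter> insert x ` {A. A \<subseteq> S \<and> shattered (F0 \<inter> F1) A} = {}"
      using insert.hyps(2) by auto
  qed
  also have "\<dots> \<le> card {A. A \<subseteq> insert x S \<and> shattered F A}"
  proof (rule card_mono)
    show "finite {A. A \<subseteq> insert x S \<and> shattered F A}" using insert.hyps(1) by simp
    have "shattered F A" if A: "A \<subseteq> S" "shattered (F0 \<union> F1) A" for A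
      unfolding shattered_def
    proof (intro allI impI)
      fix B assume "B \<subseteq> A"
      then obtain X where X: "X \<in> F0 \<union> F1" "X \<inter> A = B" using A unfolding shattered_def by blast
      show "\<exists>X\<in>F. X \<inter> A = B"
      proof (cases "X \<in> F0")
        case True
        then show ?thesis using X F0_def by auto
      next
        case False
        then obtain Y where "Y \<in> F" "X = Y - {x}" using X F1_def by auto
        moreover have "x \<notin> A" using A insert.hyps(2) by blast
        ultimately show ?thesis using X by (intro bexI[of _ Y]) auto
      qed
    qed
    moreover have "shattered F (insert x A)" if A: "A \<subseteq> S" "shattered (F0 \<inter> F1) A" for A
      unfolding shattered_def
    proof (intro allI impI)
      fix B assume B: "B \<subseteq> insert x A"
      have xA: "x \<notin> A" using A insert.hyps(2) by blast
      obtain X where X: "X \<in> F0" "X \<in> F1" "X \<inter> A = B - {x}"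
        using A(2)[unfolded shattered_def, rule_format, of "B - {x}"] B by auto
      show "\<exists>X\<in>F. X \<inter> insert x A = B"
      proof (cases "x \<in> B")
        case True
        obtain Y where "Y \<in> F" "x \<in> Y" "X = Y - {x}" using X F1_def by auto
        then show ?thesis using X B True xA by (intro bexI[of _ Y]) auto
      next
        case False
        then show ?thesis using X B xA unfolding F0_def by (intro bexI[of _ X]) auto
      qed
    qed
    ultimately show "{A. A \<subseteq> S \<and> shattered (F0 \<union> F1) A} \<union>
        insert x ` {A. A \<subseteq> S \<and> shattered (F0 \<inter> F1) A} \<subseteq> {A. A \<subseteq> insert x S \<and> shattered F A}"
      by auto
  qed
  finally show ?case .
qed

definition halfspace_trace :: "'a::real_vector set \<Rightarrow> ('a \<Rightarrow> real) \<Rightarrow> 'a set" where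
  "halfspace_trace N f = {p \<in> N. f p > 0}"

text \<open>Given a linear dependence with some positive coefficient (negate it if necessary),
  shattering provides \<open>f\<close> positive exactly where the coefficients are. Then
  \<open>u p * f p\<close> is never negative and is positive somewhere, yet these terms sum to
  \<open>f 0 = 0\<close>.\<close>

lemma shattered_halfspaces_independent:
  fixes N :: "'a::real_vector set"
  assumes sh: "shattered {halfspace_trace N f | f. linear f} A" and "finite A"
  shows "independent A"
proof (rule ccontr)
  assume "\<not> independent A"
  then obtain u v where u: "(\<Sum>v\<in>A. u v *\<^sub>R v) = 0" and v: "v \<in> A" "u v \<noteq> 0"
    using dependent_finite[OF \<open>finite A\<close>] by auto
  have False if u: "(\<Sum>v\<in>A. u v *\<^sub>R v) = 0" and v: "v \<in> A" "u v > 0" for u :: "'a \<Rightarrow> real" and v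
  proof -
    obtain f where f: "linear f" "halfspace_trace N f \<inter> A = {p \<in> A. u p > 0}"
      using sh[unfolded shattered_def, rule_format, of "{p \<in> A. u p > 0}"] by auto
    have AN: "A \<subseteq> N"
      using sh[unfolded shattered_def, rule_format, of A] by (auto simp: halfspace_trace_def)
    have sgn: "f p > 0 \<longleftrightarrow> u p > 0" if "p \<in> A" for p
      using f(2) that AN unfolding halfspace_trace_def by auto
    have "0 < (\<Sum>p\<in>A. u p * f p)"
    proof (rule sum_pos2[OF \<open>finite A\<close> v(1)])
      show "0 < u v * f v" using sgn v by simp
      show "0 \<le> u p * f p" if "p \<in> A" for p
        using sgn[OF that] by (cases "u p > 0") (auto intro: mult_nonpos_nonpos)
    qed
    also have "\<dots> = f (\<Sum>p\<in>A. u p *\<^sub>R p)"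
      using f(1) by (simp add: linear_sum linear_scale)
    finally show False using u linear_0[OF f(1)] by simp
  qed
  note pos = this
  show False
  proof (cases "u v > 0")
    case True
    then show ?thesis using pos[OF u v(1)] by blast
  next
    case False
    have "(\<Sum>v\<in>A. (- u v) *\<^sub>R v) = 0" using u by (simp add: sum_negf)
    then show ?thesis using pos[of "\<lambda>v. - u v" v] v False by simp
  qed
qed

text \<open>Shattered sets are independent in the span of \<open>B\<close>, so they have at most
  \<open>k\<close> elements; by Pajor's inequality their number bounds the number of traces.\<close>

lemma card_halfspace_traces_le:
  fixes N :: "'a::real_vector set"
  assumes "finite N" "finite B" "card B \<le> k" "N \<subseteq> span B"
  shows "card {halfspace_trace N f | f. linear f} \<le> (card N + 1) ^ k"
proof -
  let ?F = "{halfspace_trace N f | f. linear f}"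
  have "card ?F \<le> card {A. A \<subseteq> N \<and> shattered ?F A}"
    by (rule card_le_card_shattered[OF assms(1)]) (auto simp: halfspace_trace_def)
  also have "\<dots> \<le> card {A. A \<subseteq> N \<and> card A \<le> k}"
  proof (rule card_mono)
    show "finite {A. A \<subseteq> N \<and> card A \<le> k}" using assms(1) by simp
    have "card A \<le> k" if A: "A \<subseteq> N" "shattered ?F A" for A
    proof -
      have "independent A"
        using shattered_halfspaces_independent[OF A(2)] A(1) assms(1) finite_subset by blast
      then have "card A \<le> card B" using independent_span_bound[OF assms(2), of A] A(1) assms(4) by blast
      then show ?thesis using assms(3) by simp
    qed
    then show "{A. A \<subseteq> N \<and> shattered ?F A} \<subseteq> {A. A \<subseteq> N \<and> card A \<le> k}" by blast
  qed
  also have "\<dots> \<le> (card N + 1) ^ k" by (rule bounded_subsets[OF assms(1)])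
  finally show ?thesis .
qed

section \<open>Decomposing a functional along extreme rays\<close>

text \<open>The choice depends only on \<open>V\<close> and \<open>A\<close>, not on the sample that
  contains \<open>A\<close>. This is what makes an extreme ray determined by few sample points. If
  \<open>V\<close> lies in the span of \<open>A\<close>, no such functional exists and the value is
  arbitrary.\<close>

definition vanishing_functional :: "'a::real_vector set \<Rightarrow> 'a set \<Rightarrow> 'a \<Rightarrow> real" where
  "vanishing_functional V A = (SOME f. linear f \<and> (\<forall>p\<in>A. f p = 0) \<and> (\<exists>p\<in>V. f p \<noteq> 0))"

text \<open>The closed face, cut out by \<open>f = 0\<close> on \<open>Q\<close>, of the cone of functionals whose signs on \<open>N\<close>
  are compatible with the trace \<open>T\<close>.\<close>

definition dual_face :: "'a::real_vector set \<Rightarrow> 'a set \<Rightarrow> 'a set \<Rightarrow> ('a \<Rightarrow> real) set" where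
  "dual_face N T Q = {f. linear f \<and> (\<forall>p\<in>N. if p \<in> T then f p \<ge> 0 else f p \<le> 0) \<and> (\<forall>p\<in>Q. f p = 0)}"

lemma linear_lincomb_real:
  fixes f g :: "'a::real_vector \<Rightarrow> real"
  assumes "linear f" "linear g"
  shows "linear (\<lambda>v. a * f v + b * g v)"
proof -
  have "linear (\<lambda>v. a *\<^sub>R f v + b *\<^sub>R g v)"
    by (intro linear_compose_add linear_compose_scale_right assms)
  then show ?thesis by simp
qed

lemma linear_zero_on_span:
  fixes f :: "'a::real_vector \<Rightarrow> real"
  assumes "linear f" "\<And>p. p \<in> A \<Longrightarrow> f p = 0" "x \<in> span A"
  shows "f x = 0"
  using linear_eq_0_on_span[OF assms(1) assms(2) assms(3)] by blast

text \<open>A face contains a functional \<open>f\<close> with as many zeros in \<open>N\<close> as possible. Any functional vanishing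
  at those zeros is proportional to \<open>f\<close>: otherwise moving \<open>f\<close> along it until the next sign constraint
  becomes tight would give more zeros.\<close>

lemma dual_face_extreme_ray:
  fixes N :: "'a::real_vector set"
  assumes "finite N" "N \<subseteq> V" "V \<subseteq> span N" "finite B" "card B \<le> k" "N \<subseteq> span B" "Q \<subseteq> N"
    and f0: "f0 \<in> dual_face N T Q" "\<exists>p\<in>N. f0 p \<noteq> 0"
  shows "\<exists>A\<subseteq>N. card A \<le> k \<and> (\<exists>s\<in>{1,-1}. (\<lambda>p. s * vanishing_functional V A p) \<in> dual_face N T Q) \<and>
    (\<exists>p\<in>N. vanishing_functional V A p \<noteq> 0)"
proof -
  let ?P = "\<lambda>f. f \<in> dual_face N T Q \<and> (\<exists>p\<in>N. f p \<noteq> 0)"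
  let ?Z = "\<lambda>f. {p\<in>N. f p = 0}"
  have "card (?Z f) \<le> card N" for f :: "'a \<Rightarrow> real" by (rule card_mono[OF assms(1)]) blast
  then have "\<exists>f. ?P f \<and> (\<forall>g. ?P g \<longrightarrow> card (?Z g) \<le> card (?Z f))"
    by (intro ex_has_greatest_nat[of ?P f0 "\<lambda>f. card (?Z f)" "Suc (card N)"] conjI f0 allI impI)
      (simp add: le_imp_less_Suc)
  then obtain f where fm: "?P f \<and> (\<forall>g. ?P g \<longrightarrow> card (?Z g) \<le> card (?Z f))"
    by (rule exE)
  have f: "?P f" by (rule conjunct1[OF fm])
  have fmax: "card (?Z g) \<le> card (?Z f)" if "?P g" for g
    using conjunct2[OF fm] that by (elim allE impE)
  \<comment> \<open>\<open>A\<close> spans all zeros of \<open>f\<close> in \<open>N\<close>, so a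
    functional vanishing on \<open>A\<close> vanishes at all of them, while independence keeps
    \<open>A\<close> small.\<close>
  obtain A where A: "A \<subseteq> ?Z f" "independent A" "?Z f \<subseteq> span A"
    using maximal_independent_subset[of "?Z f"] by blast
  have cardA: "card A \<le> k"
  proof -
    have "A \<subseteq> span B" using A(1) assms(6) by blast
    then show ?thesis using independent_span_bound[OF assms(4) A(2)] assms(5) by linarith
  qed
  define g where "g = vanishing_functional V A"
  have linf: "linear f" using f by (simp add: dual_face_def)
  have ex: "\<exists>g::'a \<Rightarrow> real. linear g \<and> (\<forall>p\<in>A. g p = 0) \<and> (\<exists>p\<in>V. g p \<noteq> 0)"
    using f A(1) assms(2) linf by (intro exI[of _ f]) auto
  have g: "linear g" "\<And>p. p \<in> A \<Longrightarrow> g p = 0" "\<exists>p\<in>V. g p \<noteq> 0"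
    using someI_ex[OF ex] unfolding g_def vanishing_functional_def by blast+
  have gZ: "g p = 0" if "p \<in> ?Z f" for p
    using linear_zero_on_span[OF g(1,2), of A p] that A(3) by blast
  have gN: "\<exists>p\<in>N. g p \<noteq> 0"
    using linear_zero_on_span[OF g(1), of N] g(3) assms(3) by blast
  define M where "M = {p\<in>N. g p \<noteq> 0}"
  have "finite M" "M \<noteq> {}" using assms(1) gN by (auto simp: M_def)
  then obtain p0 where p0: "p0 \<in> M" and pmin: "\<And>p. p \<in> M \<Longrightarrow> \<bar>f p0 / g p0\<bar> \<le> \<bar>f p / g p\<bar>"
    using ex_is_arg_min_if_finite[of M "\<lambda>p. \<bar>f p / g p\<bar>"] by (auto simp: is_arg_min_linorder)
  \<comment> \<open>The ratio of least absolute value gives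
    \<open>\<bar>t * g p\<bar> \<le> \<bar>f p\<bar>\<close> on \<open>N\<close>. Hence
    \<open>f - t * g\<close> violates no sign constraint, and \<open>p0\<close> becomes a
    zero.\<close>
  define t where "t = f p0 / g p0"
  have bd: "\<bar>t * g p\<bar> \<le> \<bar>f p\<bar>" if "p \<in> N" for p
  proof (cases "g p = 0")
    case False
    then have "\<bar>t\<bar> \<le> \<bar>f p\<bar> / \<bar>g p\<bar>" using pmin[of p] that by (simp add: M_def t_def abs_divide)
    then show ?thesis using False by (simp add: abs_mult pos_le_divide_eq)
  qed simp
  define h where "h = (\<lambda>v. 1 * f v + (- t) * g v)"
  have linh: "linear h" unfolding h_def by (rule linear_lincomb_real[OF linf g(1)])
  have hface: "h \<in> dual_face N T Q"
    unfolding dual_face_def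
  proof (intro CollectI conjI ballI linh)
    fix p assume "p \<in> N"
    moreover have "if p \<in> T then f p \<ge> 0 else f p \<le> 0" using f \<open>p \<in> N\<close> by (simp add: dual_face_def)
    ultimately show "if p \<in> T then h p \<ge> 0 else h p \<le> 0"
      using bd[of p] by (auto simp: h_def split: if_splits)
  next
    fix p assume "p \<in> Q"
    then have "p \<in> ?Z f" using f assms(7) by (auto simp: dual_face_def)
    then show "h p = 0" using gZ[of p] by (simp add: h_def)
  qed
  have fp0: "f p0 \<noteq> 0" using p0 gZ[of p0] by (auto simp: M_def)
  \<comment> \<open>Otherwise \<open>h\<close> would be a nonzero member of the face with all zeros
    of \<open>f\<close> and in addition \<open>p0\<close>, against maximality.\<close>
  have h0: "h p = 0" if "p \<in> N" for p
  proof (rule ccontr)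
    assume "h p \<noteq> 0"
    then have "card (?Z h) \<le> card (?Z f)" using fmax[of h] hface that by blast
    moreover have "insert p0 (?Z f) \<subseteq> ?Z h"
      using p0 gZ by (auto simp: h_def M_def t_def)
    then have "card (insert p0 (?Z f)) \<le> card (?Z h)" using assms(1) by (intro card_mono) auto
    moreover have "card (insert p0 (?Z f)) = Suc (card (?Z f))" using assms(1) fp0 by simp
    ultimately show False by simp
  qed
  have t0: "t \<noteq> 0" using fp0 p0 by (simp add: t_def M_def)
  \<comment> \<open>Now \<open>f = t * g\<close> on \<open>N\<close>. The face is a cone, so only
    the sign of \<open>t\<close> matters.\<close>
  define s :: real where "s = sgn t"
  have s: "s \<in> {1,-1}" using t0 by (auto simp: s_def sgn_if)
  have eq: "s * g p = f p / \<bar>t\<bar>" if "p \<in> N" for p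
  proof -
    have "f p = t * g p" using h0[OF that] by (simp add: h_def)
    then show ?thesis using t0 by (simp add: s_def sgn_if)
  qed
  have "(\<lambda>p. s * g p) \<in> dual_face N T Q"
    unfolding dual_face_def
  proof (intro CollectI conjI ballI)
    show "linear (\<lambda>p. s * g p)" using linear_lincomb_real[OF g(1) g(1), of s 0] by simp
    fix p assume "p \<in> N"
    then show "if p \<in> T then s * g p \<ge> 0 else s * g p \<le> 0"
      using f eq[of p] by (auto simp: dual_face_def divide_nonpos_nonneg)
  next
    fix p assume "p \<in> Q"
    then show "s * g p = 0" using f eq[of p] assms(7) by (auto simp: dual_face_def)
  qed
  then have "\<exists>s\<in>{1,-1}. (\<lambda>p. s * vanishing_functional V A p) \<in> dual_face N T Q"
    using s unfolding g_def by (rule rev_bexI[rotated])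
  moreover have "A \<subseteq> N" using A(1) by blast
  ultimately show ?thesis using cardA gN[unfolded g_def] by (intro exI[of _ A] conjI)
qed

text \<open>A fixed choice for each face, so that the rays used for a functional can be recovered
  from its trace and from the points that cut out the successive faces. The form
  \<open>s * vanishing_functional V A\<close> ties the ray to at most \<open>k\<close> points of
  \<open>N\<close>.\<close>

definition extreme_ray :: "'a::real_vector set \<Rightarrow> 'a set \<Rightarrow> nat \<Rightarrow> 'a set \<Rightarrow> 'a set \<Rightarrow> 'a \<Rightarrow> real" where
  "extreme_ray V N k T Q = (SOME r. r \<in> dual_face N T Q \<and> (\<exists>p\<in>N. r p \<noteq> 0) \<and>
     (\<exists>A\<subseteq>N. card A \<le> k \<and> (\<exists>s\<in>{1,-1}. r = (\<lambda>p. s * vanishing_functional V A p))))"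

text \<open>The rays met by the greedy decomposition: take the ray of the current face, then
  restrict the face by the next point of the list. The list thus encodes the rays, and counting
  lists counts ray sets.\<close>

primrec ray_set :: "('a set \<Rightarrow> 'a \<Rightarrow> real) \<Rightarrow> 'a set \<Rightarrow> 'a list \<Rightarrow> ('a \<Rightarrow> real) set" where
  "ray_set \<rho> Q [] = {}"
| "ray_set \<rho> Q (p # ps) = insert (\<rho> Q) (ray_set \<rho> (insert p Q) ps)"

lemma ray_set_bound: "finite (ray_set \<rho> Q ps) \<and> card (ray_set \<rho> Q ps) \<le> length ps"
  by (induction ps arbitrary: Q) (auto simp: card_insert_if le_SucI)

lemma extreme_ray:
  fixes N :: "'a::real_vector set"
  assumes "finite N" "N \<subseteq> V" "V \<subseteq> span N" "finite B" "card B \<le> k" "N \<subseteq> span B" "Q \<subseteq> N"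
    and "f \<in> dual_face N T Q" "\<exists>p\<in>N. f p \<noteq> 0"
  shows "extreme_ray V N k T Q \<in> dual_face N T Q \<and> (\<exists>p\<in>N. extreme_ray V N k T Q p \<noteq> 0) \<and>
     (\<exists>A\<subseteq>N. card A \<le> k \<and> (\<exists>s\<in>{1,-1}. extreme_ray V N k T Q = (\<lambda>p. s * vanishing_functional V A p)))"
proof -
  obtain A s where A: "A \<subseteq> N" "card A \<le> k" "s \<in> {1,-1::real}"
      "(\<lambda>p. s * vanishing_functional V A p) \<in> dual_face N T Q"
      "\<exists>p\<in>N. vanishing_functional V A p \<noteq> 0"
    using dual_face_extreme_ray[OF assms] by blast
  have nz: "\<exists>p\<in>N. s * vanishing_functional V A p \<noteq> 0" using A(3,5) by auto
  have "\<exists>r. r \<in> dual_face N T Q \<and> (\<exists>p\<in>N. r p \<noteq> 0) \<and>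
      (\<exists>A\<subseteq>N. card A \<le> k \<and> (\<exists>s\<in>{1,-1}. r = (\<lambda>p. s * vanishing_functional V A p)))"
  proof (rule exI, rule conjI[OF A(4) conjI[OF nz]])
    show "\<exists>A'\<subseteq>N. card A' \<le> k \<and>
        (\<exists>s'\<in>{1,-1}. (\<lambda>p. s * vanishing_functional V A p) = (\<lambda>p. s' * vanishing_functional V A' p))"
      using A(1-3) by (intro exI[of _ A] conjI bexI[of _ s]) simp_all
  qed
  then show ?thesis unfolding extreme_ray_def by (rule someI_ex)
qed

text \<open>Subtract from \<open>f\<close> the largest multiple of an extreme ray that keeps it in its face. The difference
  lies in a proper face, obtained by adding a point to the independent set \<open>Q\<close>, so there are at most
  \<open>k\<close> steps.\<close>

lemma dual_face_decomposition:
  fixes N :: "'a::real_vector set"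
  assumes N: "finite N" "N \<subseteq> V" "V \<subseteq> span N" "finite B" "card B \<le> k" "N \<subseteq> span B"
    and "independent Q" "Q \<subseteq> N" "k \<le> card Q + j" "f \<in> dual_face N T Q"
  defines "\<rho> \<equiv> extreme_ray V N k T"
  shows "\<exists>ps t. set ps \<subseteq> N \<and> length ps \<le> j \<and> (\<forall>r. t r \<ge> 0) \<and>
    (\<forall>v\<in>V. f v = (\<Sum>r\<in>ray_set \<rho> Q ps. t r * r v)) \<and>
    (\<forall>r\<in>ray_set \<rho> Q ps. r \<in> dual_face N T {} \<and>
       (\<exists>A\<subseteq>N. card A \<le> k \<and> (\<exists>s\<in>{1,-1}. r = (\<lambda>p. s * vanishing_functional V A p))))"
  using assms(7-10)
proof (induction j arbitrary: Q f)
  case (0 Q f)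
  have linf: "linear f" using 0 by (simp add: dual_face_def)
  have fQ: "\<And>p. p \<in> Q \<Longrightarrow> f p = 0" using 0 by (simp add: dual_face_def)
  \<comment> \<open>Here \<open>Q\<close> has at least \<open>k\<close> independent points in the
    span of \<open>B\<close>, so no further point of \<open>N\<close> is independent of it.\<close>
  have "p \<in> span Q" if "p \<in> N" for p
  proof (rule ccontr)
    assume p: "p \<notin> span Q"
    have "independent (insert p Q)" by (rule independent_insertI[OF p 0(1)])
    then have "card (insert p Q) \<le> card B"
      using independent_span_bound[OF N(4)] 0(2) N(6) that by blast
    moreover have "card (insert p Q) = Suc (card Q)"
    proof -
      have "p \<notin> Q" using p span_base by blast
      then show ?thesis using finite_subset[OF 0(2) N(1)] by simp
    qed
    ultimately show False using 0(3) N(5) by simp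
  qed
  then have "f p = 0" if "p \<in> N" for p using linear_zero_on_span[OF linf fQ] that by blast
  then have "f v = 0" if "v \<in> V" for v using linear_zero_on_span[OF linf, of N] that N(3) by blast
  then show ?case by (intro exI[of _ "[]"] exI[of _ "\<lambda>_. 0"]) auto
next
  case (Suc j Q f)
  have linf: "linear f" using Suc by (simp add: dual_face_def)
  show ?case
  proof (cases "\<exists>p\<in>N. f p \<noteq> 0")
    case False
    then have "f v = 0" if "v \<in> V" for v using linear_zero_on_span[OF linf, of N] that N(3) by blast
    then show ?thesis by (intro exI[of _ "[]"] exI[of _ "\<lambda>_. 0"]) auto
  next
    case True
    define r where "r = \<rho> Q"
    have r: "r \<in> dual_face N T Q" "\<exists>p\<in>N. r p \<noteq> 0"
      "\<exists>A\<subseteq>N. card A \<le> k \<and> (\<exists>s\<in>{1,-1}. r = (\<lambda>p. s * vanishing_functional V A p))"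
      using extreme_ray[OF N Suc.prems(2,4) True] unfolding r_def \<rho>_def by simp_all
    have linr: "linear r" using r by (simp add: dual_face_def)
    define M where "M = {p\<in>N. r p \<noteq> 0}"
    have "finite M" "M \<noteq> {}" using N(1) r by (auto simp: M_def)
    then obtain q where q: "q \<in> M" and qmin: "\<And>p. p \<in> M \<Longrightarrow> f q / r q \<le> f p / r p"
      using ex_is_arg_min_if_finite[of M "\<lambda>p. f p / r p"] by (auto simp: is_arg_min_linorder)
    \<comment> \<open>The signs of \<open>f\<close> and \<open>r\<close> agree on \<open>N\<close>,
      so all ratios are nonnegative; the least one is the largest multiple of \<open>r\<close> that
      can be subtracted.\<close>
    define t where "t = f q / r q"
    have sf: "if p \<in> T then f p \<ge> 0 else f p \<le> 0" if "p \<in> N" for p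
      using Suc.prems(4) that by (simp add: dual_face_def)
    have sr: "if p \<in> T then r p \<ge> 0 else r p \<le> 0" if "p \<in> N" for p
      using r(1) that by (simp add: dual_face_def)
    have t0: "t \<ge> 0" using sf[of q] sr[of q] q
      by (auto simp: t_def M_def split: if_splits intro: divide_nonpos_nonpos)
    define h where "h = (\<lambda>v. 1 * f v + (- t) * r v)"
    have h: "h \<in> dual_face N T (insert q Q)"
      unfolding dual_face_def
    proof (intro CollectI conjI ballI)
      show "linear h" unfolding h_def by (rule linear_lincomb_real[OF linf linr])
      fix p assume p: "p \<in> N"
      show "if p \<in> T then h p \<ge> 0 else h p \<le> 0"
      proof (cases "r p = 0")
        case True
        then show ?thesis using sf[OF p] by (simp add: h_def)
      next
        case False
        then have le: "t \<le> f p / r p" using qmin[of p] p by (simp add: t_def M_def)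
        show ?thesis
        proof (cases "p \<in> T")
          case True
          then have "r p > 0" using sr[OF p] False by simp
          then show ?thesis using le True by (simp add: h_def pos_le_divide_eq)
        next
          case pT: False
          then have "r p < 0" using sr[OF p] False by simp
          then show ?thesis using le pT by (simp add: h_def neg_le_divide_eq)
        qed
      qed
    next
      fix p assume "p \<in> insert q Q"
      then show "h p = 0"
        using Suc.prems(4) r(1) q by (auto simp: dual_face_def h_def t_def M_def)
    qed
    \<comment> \<open>\<open>r\<close> vanishes on \<open>Q\<close>, hence on its span, but not at
      \<open>q\<close>.\<close>
    have qspan: "q \<notin> span Q"
      using linear_zero_on_span[OF linr, of Q q] r(1) q by (auto simp: dual_face_def M_def)
    have "finite Q" using Suc.prems(2) N(1) finite_subset by blast
    moreover have "q \<notin> Q" using qspan span_base by blast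
    ultimately have kj: "k \<le> card (insert q Q) + j" using Suc.prems(3) by simp
    have "insert q Q \<subseteq> N" using q Suc.prems(2) by (simp add: M_def)
    note IH0 = Suc.IH[OF independent_insertI[OF qspan Suc.prems(1)] this kj h]
    obtain ps u where IH: "set ps \<subseteq> N" "length ps \<le> j" "\<forall>r. u r \<ge> 0"
      "\<forall>v\<in>V. h v = (\<Sum>r\<in>ray_set \<rho> (insert q Q) ps. u r * r v)"
      "\<forall>r\<in>ray_set \<rho> (insert q Q) ps. r \<in> dual_face N T {} \<and>
        (\<exists>A\<subseteq>N. card A \<le> k \<and> (\<exists>s\<in>{1,-1}. r = (\<lambda>p. s * vanishing_functional V A p)))"
      using IH0 by (elim exE conjE) (rule that; assumption)
    define R where "R = ray_set \<rho> (insert q Q) ps"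
    have finR: "finite R" unfolding R_def using ray_set_bound by blast
    \<comment> \<open>The induction hypothesis does not exclude \<open>r \<in> R\<close>; in that
      case the two coefficients of \<open>r\<close> add up.\<close>
    define u' where "u' = (\<lambda>x. (if x \<in> R then u x else 0) + (if x = r then t else 0))"
    have fv: "f v = (\<Sum>x\<in>ray_set \<rho> Q (q # ps). u' x * x v)" if "v \<in> V" for v
    proof -
      have "f v = h v + t * r v" by (simp add: h_def)
      also have "h v = (\<Sum>x\<in>R. u x * x v)" using IH(4) that R_def by blast
      also have "\<dots> = (\<Sum>x\<in>insert r R. (if x \<in> R then u x else 0) * x v)"
        by (rule sum.mono_neutral_cong_left) (use finR in auto)
      also have "t * r v = (\<Sum>x\<in>insert r R. (if x = r then t * x v else 0))"
        using finR by (simp add: sum.delta)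
      also have "(\<Sum>x\<in>insert r R. (if x \<in> R then u x else 0) * x v) + \<dots> =
          (\<Sum>x\<in>insert r R. u' x * x v)"
        unfolding sum.distrib[symmetric] u'_def by (intro sum.cong) (auto simp: algebra_simps)
      finally show ?thesis by (simp add: R_def r_def)
    qed
    have u': "\<forall>x. u' x \<ge> 0" using IH(3) t0 by (auto simp: u'_def)
    have r0: "r \<in> dual_face N T {}" using r(1) by (simp add: dual_face_def)
    show ?thesis
    proof (intro exI[of _ "q # ps"] exI[of _ u'] conjI u' ballI)
      show "set (q # ps) \<subseteq> N" using IH(1) q by (simp add: M_def)
      show "length (q # ps) \<le> Suc j" using IH(2) by simp
      show "f v = (\<Sum>x\<in>ray_set \<rho> Q (q # ps). u' x * x v)" if "v \<in> V" for v by (rule fv[OF that])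
      fix x assume "x \<in> ray_set \<rho> Q (q # ps)"
      then consider "x = r" | "x \<in> ray_set \<rho> (insert q Q) ps" by (auto simp: r_def)
      then show "x \<in> dual_face N T {}"
        "\<exists>A\<subseteq>N. card A \<le> k \<and> (\<exists>s\<in>{1,-1}. x = (\<lambda>p. s * vanishing_functional V A p))"
        using r0 r(3) IH(5) by (cases; simp)+
    qed
  qed
qed

section \<open>Random sampling\<close>

text \<open>Every \<open>\<Phi> j\<close> is determined by few entries of the sample \<open>s\<close>, so conditioning on those entries
  leaves the others independent; a union bound over \<open>j\<close> does not involve the size of \<open>V\<close>.\<close>

lemma determined_sets_sample:
  fixes V :: "'a set" and \<Phi> :: "'j \<Rightarrow> (nat \<Rightarrow> 'a) \<Rightarrow> 'a set" and \<epsilon> :: real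
  assumes "finite V" "V \<noteq> {}" "finite J"
    and D: "\<And>j. j \<in> J \<Longrightarrow> D j \<subseteq> {..<m} \<and> card (D j) \<le> q"
    and dep: "\<And>j s s'. j \<in> J \<Longrightarrow> (\<And>i. i \<in> D j \<Longrightarrow> s i = s' i) \<Longrightarrow> \<Phi> j s = \<Phi> j s'"
    and \<epsilon>: "0 \<le> \<epsilon>" "\<epsilon> \<le> 1"
    and small: "real (card J) * (1 - \<epsilon>) ^ (m - q) < 1"
  shows "\<exists>s. (\<forall>i<m. s i \<in> V) \<and>
    (\<forall>j\<in>J. (\<forall>i<m. s i \<notin> \<Phi> j s) \<longrightarrow> real (card (\<Phi> j s \<inter> V)) \<le> \<epsilon> * card V)"
proof -
  let ?S = "{..<m} \<rightarrow>\<^sub>E V"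
  define big where "big = (\<lambda>j s. real (card (\<Phi> j s \<inter> V)) > \<epsilon> * card V)"
  define Bad where "Bad = (\<lambda>j. {s \<in> ?S. (\<forall>i<m. s i \<notin> \<Phi> j s) \<and> big j s})"
  have finS: "finite ?S" using assms(1) by (simp add: finite_PiE)
  \<comment> \<open>Once the entries at \<open>D j\<close> are fixed, \<open>\<Phi> j s\<close> is
    fixed too. In a bad sample all other entries avoid this large set, which leaves at most
    \<open>(1 - \<epsilon>) * card V\<close> values for each.\<close>
  have bad: "real (card (Bad j)) \<le> real (card V) ^ m * (1 - \<epsilon>) ^ (m - q)" if j: "j \<in> J" for j
  proof -
    have Dj: "D j \<subseteq> {..<m}" "card (D j) \<le> q" "finite (D j)" using D[OF j] finite_subset by auto
    define C where "C = {..<m} - D j"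
    have cardC: "card C = m - card (D j)" using Dj by (simp add: C_def card_Diff_subset)
    have cDm: "card (D j) \<le> m" using card_mono[OF _ Dj(1)] by simp
    define G where "G = {g \<in> D j \<rightarrow>\<^sub>E V. big j g}"
    have finG: "finite G" unfolding G_def using assms(1) Dj(3) by (simp add: finite_PiE)
    define X where "X = (SIGMA g:G. C \<rightarrow>\<^sub>E (V - \<Phi> j g))"
    have finX: "finite X" unfolding X_def
      using finG assms(1) by (auto simp: C_def intro!: finite_SigmaI finite_PiE)
    let ?h = "\<lambda>s::nat \<Rightarrow> 'a. (restrict s (D j), restrict s C)"
    have "inj_on ?h (Bad j)"
    proof (rule inj_onI)
      fix s s' assume s: "s \<in> Bad j" "s' \<in> Bad j" "?h s = ?h s'"
      have eD: "restrict s (D j) = restrict s' (D j)" and eC: "restrict s C = restrict s' C"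
        using s(3) by auto
      show "s = s'"
      proof (rule PiE_ext[of s "{..<m}" "\<lambda>_. V"])
        fix i assume "i \<in> {..<m}"
        then show "s i = s' i"
          using fun_cong[OF eD, of i] fun_cong[OF eC, of i] by (cases "i \<in> D j") (auto simp: C_def)
      qed (use s in \<open>auto simp: Bad_def\<close>)
    qed
    moreover have "?h ` Bad j \<subseteq> X"
    proof
      fix y assume "y \<in> ?h ` Bad j"
      then obtain s where s: "s \<in> Bad j" "y = ?h s" by blast
      have eq: "\<Phi> j (restrict s (D j)) = \<Phi> j s" by (rule dep[OF j]) simp
      have sV: "s i \<in> V" if "i < m" for i using s(1) that by (auto simp: Bad_def PiE_iff)
      have "restrict s (D j) \<in> G"
        using s(1) Dj(1) sV eq by (auto simp: G_def big_def Bad_def)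
      moreover have "restrict s C \<in> C \<rightarrow>\<^sub>E (V - \<Phi> j (restrict s (D j)))"
        using s(1) sV unfolding eq by (auto simp: Bad_def C_def)
      ultimately show "y \<in> X" unfolding X_def s(2) by blast
    qed
    ultimately have "card (Bad j) \<le> card X" using card_inj_on_le finX by blast
    also have "card X = (\<Sum>g\<in>G. card (C \<rightarrow>\<^sub>E (V - \<Phi> j g)))"
      unfolding X_def by (rule card_SigmaI) (use finG assms(1) in \<open>auto simp: C_def intro!: finite_PiE\<close>)
    finally have "real (card (Bad j)) \<le> (\<Sum>g\<in>G. real (card (C \<rightarrow>\<^sub>E (V - \<Phi> j g))))"
      by (simp flip: of_nat_sum)
    also have "\<dots> \<le> (\<Sum>g\<in>G. ((1 - \<epsilon>) * card V) ^ (m - card (D j)))"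
    proof (rule sum_mono)
      fix g assume "g \<in> G"
      then have "\<epsilon> * card V < card (\<Phi> j g \<inter> V)" by (simp add: G_def big_def)
      moreover have "card (V - \<Phi> j g) + card (\<Phi> j g \<inter> V) = card V"
        using assms(1) card_Diff_subset_Int[of V "\<Phi> j g"] card_mono[of V "V \<inter> \<Phi> j g"]
        by (simp add: Int_commute)
      ultimately have "real (card (V - \<Phi> j g)) \<le> (1 - \<epsilon>) * card V" by (simp add: algebra_simps)
      moreover have "card (C \<rightarrow>\<^sub>E (V - \<Phi> j g)) = card (V - \<Phi> j g) ^ (m - card (D j))"
        by (simp add: card_PiE C_def cardC[unfolded C_def])
      ultimately show "real (card (C \<rightarrow>\<^sub>E (V - \<Phi> j g))) \<le> ((1 - \<epsilon>) * card V) ^ (m - card (D j))"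
        by (simp add: power_mono)
    qed
    also have "\<dots> = card G * ((1 - \<epsilon>) * card V) ^ (m - card (D j))" by simp
    also have "\<dots> \<le> real (card V ^ card (D j)) * ((1 - \<epsilon>) * card V) ^ (m - card (D j))"
    proof (rule mult_right_mono)
      have "card G \<le> card (D j \<rightarrow>\<^sub>E V)"
        unfolding G_def using assms(1) Dj(3) by (intro card_mono) (auto intro: finite_PiE)
      then show "real (card G) \<le> real (card V ^ card (D j))" using Dj(3) by (simp add: card_PiE del: of_nat_power)
    qed (use \<epsilon> in simp)
    also have "\<dots> = real (card V) ^ m * (1 - \<epsilon>) ^ (m - card (D j))"
    proof -
      have "real (card V) ^ m = real (card V) ^ card (D j) * real (card V) ^ (m - card (D j))"
        using cDm by (simp flip: power_add)
      then show ?thesis by (simp add: power_mult_distrib)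
    qed
    \<comment> \<open>The base is at most 1, so replacing \<open>card (D j)\<close> by its bound
      \<open>q\<close> lowers the exponent and can only enlarge the power.\<close>
    also have "\<dots> \<le> real (card V) ^ m * (1 - \<epsilon>) ^ (m - q)"
      using \<epsilon> Dj(2) by (intro mult_left_mono power_decreasing) auto
    finally show ?thesis .
  qed
  have finB: "finite (\<Union>j\<in>J. Bad j)" using assms(3) finS by (simp add: Bad_def)
  have "real (card (\<Union>j\<in>J. Bad j)) \<le> real (\<Sum>j\<in>J. card (Bad j))"
    using card_UN_le[OF assms(3)] of_nat_mono by blast
  also have "\<dots> = (\<Sum>j\<in>J. real (card (Bad j)))" by simp
  also have "\<dots> \<le> (\<Sum>j\<in>J. real (card V) ^ m * (1 - \<epsilon>) ^ (m - q))" by (intro sum_mono bad)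
  also have "\<dots> = real (card V) ^ m * (real (card J) * (1 - \<epsilon>) ^ (m - q))" by simp
  also have "\<dots> < real (card V) ^ m * 1"
    using small assms(1,2) by (intro mult_strict_left_mono) (auto simp: card_gt_0_iff)
  also have "\<dots> = real (card ?S)" by (simp add: card_PiE)
  finally have "\<not> ?S \<subseteq> (\<Union>j\<in>J. Bad j)"
    using card_mono[OF finB, of ?S] by linarith
  then obtain s where s: "s \<in> ?S" "\<And>j. j \<in> J \<Longrightarrow> s \<notin> Bad j" by blast
  show ?thesis
  proof (intro exI[of _ s] conjI ballI allI impI)
    show "s i \<in> V" if "i < m" for i using s(1) that by (auto simp: PiE_iff)
    show "real (card (\<Phi> j s \<inter> V)) \<le> \<epsilon> * card V" if "j \<in> J" "\<forall>i<m. s i \<notin> \<Phi> j s" for j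
      using s(2)[OF that(1)] s(1) that(2) unfolding Bad_def big_def by force
  qed
qed

text \<open>The numerical condition of the union bound with \<open>\<epsilon> = 1 / (4 k^2)\<close>.
  The first factor, which bounds the number of pairs of index sets with a sign, is at most
  \<open>exp (25 k^2)\<close>. The exponent is at least \<open>102 k^4\<close>, so the second factor
  is at most \<open>exp (- 25.5 k^2)\<close>.\<close>

lemma sample_size_suffices:
  fixes k :: nat
  assumes "k \<ge> 1"
  shows "real (2 * ((104 * k ^ 4 + k + 1) ^ k) ^ 2) * (1 - 1 / (4 * real k ^ 2)) ^ (104 * k ^ 4 - 2 * k) < 1"
proof -
  define K where "K = real k"
  have K: "K \<ge> 1" using assms by (simp add: K_def)
  have kk: "k \<le> k ^ 4" using assms by (simp add: self_le_power)
  have k1: "1 \<le> k ^ 4" using assms by simp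
  have e2: "(2::real) \<le> exp 1" using exp_ge_add_one_self[of 1] by simp
  have "real (104 * k ^ 4 + k + 1) \<le> 106 * K ^ 4"
  proof -
    have "104 * k ^ 4 + k + 1 \<le> 106 * k ^ 4" using kk k1 by linarith
    then have "real (104 * k ^ 4 + k + 1) \<le> real (106 * k ^ 4)" by (rule of_nat_mono)
    then show ?thesis by (simp add: K_def)
  qed
  also have "\<dots> \<le> exp 8 * exp K ^ 4"
  proof (intro mult_mono power_mono)
    have "(106::real) \<le> 2 ^ 8" by simp
    also have "\<dots> \<le> exp 1 ^ 8" by (intro power_mono e2) simp
    also have "\<dots> = exp 8" by (simp flip: exp_of_nat_mult)
    finally show "(106::real) \<le> exp 8" .
    show "K \<le> exp K" using exp_ge_add_one_self[of K] by linarith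
  qed (use K in auto)
  also have "\<dots> = exp (8 + 4 * K)" by (simp add: exp_add flip: exp_of_nat_mult)
  also have "\<dots> \<le> exp (12 * K)" using K by simp
  finally have M: "real (104 * k ^ 4 + k + 1) \<le> exp (12 * K)" .
  have "real (2 * ((104 * k ^ 4 + k + 1) ^ k) ^ 2) = 2 * real (104 * k ^ 4 + k + 1) ^ (k * 2)"
    by (simp add: power_mult)
  also have "\<dots> \<le> exp 1 * exp (12 * K) ^ (k * 2)"
    by (intro mult_mono power_mono M e2) auto
  also have "\<dots> = exp (1 + 24 * K\<^sup>2)"
    by (simp add: exp_add K_def power2_eq_square flip: exp_of_nat_mult)
  also have "\<dots> \<le> exp (25 * K\<^sup>2)" using K by simp
  finally have J: "real (2 * ((104 * k ^ 4 + k + 1) ^ k) ^ 2) \<le> exp (25 * K\<^sup>2)" .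
  define n where "n = 104 * k ^ 4 - 2 * k"
  have "102 * k ^ 4 \<le> n" unfolding n_def using kk by linarith
  then have "real (102 * k ^ 4) \<le> real n" by (rule of_nat_mono)
  then have "102 * K ^ 4 \<le> real n" by (simp add: K_def)
  then have "102 * K ^ 4 / (4 * K\<^sup>2) \<le> n / (4 * K\<^sup>2)" using K by (intro divide_right_mono) auto
  moreover have "102 * K ^ 4 / (4 * K\<^sup>2) = 25.5 * K\<^sup>2"
    using K by (simp add: field_simps flip: power_add)
  ultimately have n: "25.5 * K\<^sup>2 \<le> n / (4 * K\<^sup>2)" by simp
  have K2: "1 \<le> K\<^sup>2" using K by simp
  have x1: "0 \<le> 1 - 1 / (4 * K\<^sup>2)"
  proof -
    have "1 / (4 * K\<^sup>2) \<le> 1" by (subst divide_le_eq_1_pos) (use K2 in linarith)+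
    then show ?thesis by simp
  qed
  have "(1 - 1 / (4 * K\<^sup>2)) ^ n \<le> exp (- 1 / (4 * K\<^sup>2)) ^ n"
  proof (intro power_mono)
    show "1 - 1 / (4 * K\<^sup>2) \<le> exp (- 1 / (4 * K\<^sup>2))"
      using exp_ge_add_one_self[of "- 1 / (4 * K\<^sup>2)"] by simp
  qed (rule x1)
  also have "\<dots> = exp (- (n / (4 * K\<^sup>2)))" by (simp flip: exp_of_nat_mult)
  also have "\<dots> \<le> exp (- (25.5 * K\<^sup>2))" using n by simp
  finally have "real (2 * ((104 * k ^ 4 + k + 1) ^ k) ^ 2) * (1 - 1 / (4 * K\<^sup>2)) ^ n
      \<le> exp (25 * K\<^sup>2) * exp (- (25.5 * K\<^sup>2))"
    using J x1 by (intro mult_mono) auto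
  also have "\<dots> = exp (- (0.5 * K\<^sup>2))" by (simp flip: exp_add)
  also have "\<dots> < 1" using K by simp
  finally show ?thesis by (simp add: n_def K_def)
qed

section \<open>Halfspace containers\<close>

text \<open>\<open>N\<close> is a random sample of \<open>V\<close> together with a basis, which makes every cell pointed.\<close>

lemma separation_net:
  fixes V :: "'a::real_vector set"
  assumes V: "finite V" "V \<noteq> {}" and k: "k \<ge> 1" "finite B" "card B \<le> k" "V \<subseteq> span B"
  shows "\<exists>N\<subseteq>V. V \<subseteq> span N \<and> card N \<le> 104 * k ^ 4 + k \<and>
    (\<forall>A\<subseteq>N. \<forall>A'\<subseteq>N. \<forall>\<sigma>\<in>{1,-1}. card A \<le> k \<longrightarrow> card A' \<le> k \<longrightarrow>
      (\<forall>p\<in>N. \<not> \<sigma> * (vanishing_functional V A p * vanishing_functional V A' p) < 0) \<longrightarrow>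
      real (card {v\<in>V. \<sigma> * (vanishing_functional V A v * vanishing_functional V A' v) < 0})
        \<le> 1 / (4 * real k ^ 2) * card V)"
proof -
  define m where "m = 104 * k ^ 4"
  define M where "M = m + k"
  obtain E where E: "E \<subseteq> V" "independent E" "V \<subseteq> span E" using maximal_independent_subset[of V] by blast
  have "E \<subseteq> span B" using E(1) k(4) by blast
  then have cardE: "finite E" "card E \<le> k" using independent_span_bound[OF k(2) E(2)] k(3) by auto
  obtain es where es: "set es = E" "length es = card E"
    using finite_distinct_list[OF cardE(1)] distinct_card by metis
  obtain v0 where v0: "v0 \<in> V" using V(2) by blast
  \<comment> \<open>Positions below \<open>m\<close> hold the sample, the next ones list the basis
    \<open>E\<close>, and the remaining ones are filled up with \<open>v0\<close>.\<close>
  define pt where "pt = (\<lambda>s i. if i < m then s i else if i - m < length es then es ! (i - m) else v0)"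
  let ?w = "vanishing_functional V"
  \<comment> \<open>Index sets replace point sets, so that the family of the union bound is fixed
    before the sample is drawn.\<close>
  define \<I> where "\<I> = {I. I \<subseteq> {..<M} \<and> card I \<le> k}"
  define J where "J = \<I> \<times> \<I> \<times> {1, -1::real}"
  \<comment> \<open>The points of \<open>V\<close> separated by two rays. A ray is a vanishing
    functional up to sign, and \<open>\<sigma>\<close> is the product of the two signs.\<close>
  define \<Phi> where "\<Phi> = (\<lambda>(I, I', \<sigma>) s. {v\<in>V. \<sigma> * (?w (pt s ` I) v * ?w (pt s ` I') v) < 0})"
  define D where "D = (\<lambda>(I, I', \<sigma>::real). (I \<union> I') \<inter> {..<m})"
  have finI: "finite \<I>" by (simp add: \<I>_def)
  have "card \<I> \<le> (M + 1) ^ k" using bounded_subsets[of "{..<M}" k] by (simp add: \<I>_def)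
  then have "card \<I> * (card \<I> * 2) \<le> (M + 1) ^ k * ((M + 1) ^ k * 2)" by (intro mult_le_mono) auto
  moreover have "card J = card \<I> * (card \<I> * 2)" by (simp add: J_def card_cartesian_product)
  ultimately have cardJ: "card J \<le> 2 * ((M + 1) ^ k) ^ 2" by (simp add: power2_eq_square)
  have \<epsilon>: "0 \<le> 1 / (4 * real k ^ 2)" "1 / (4 * real k ^ 2) \<le> 1"
  proof -
    have "1 \<le> real k ^ 2" using k(1) by simp
    then show "1 / (4 * real k ^ 2) \<le> 1" by (subst divide_le_eq_1_pos) linarith+
  qed simp
  have "\<exists>s. (\<forall>i<m. s i \<in> V) \<and>
    (\<forall>j\<in>J. (\<forall>i<m. s i \<notin> \<Phi> j s) \<longrightarrow> real (card (\<Phi> j s \<inter> V)) \<le> 1 / (4 * real k ^ 2) * card V)"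
  proof (rule determined_sets_sample[OF V, where D = D and q = "2 * k"])
    show "finite J" using finI by (simp add: J_def)
    show "D j \<subseteq> {..<m} \<and> card (D j) \<le> 2 * k" if jJ: "j \<in> J" for j
    proof -
      obtain I I' \<sigma> where j: "j = (I, I', \<sigma>)" "I \<in> \<I>" "I' \<in> \<I>" using jJ by (auto simp: J_def)
      have fin: "finite (I \<union> I')" using j(2,3) finite_subset by (auto simp: \<I>_def)
      have "card ((I \<union> I') \<inter> {..<m}) \<le> card (I \<union> I')" by (rule card_mono[OF fin]) simp
      also have "\<dots> \<le> card I + card I'" by (rule card_Un_le)
      also have "\<dots> \<le> 2 * k" using j(2,3) by (simp add: \<I>_def)
      finally show ?thesis by (simp add: D_def j(1))
    qed
    show "\<Phi> j s = \<Phi> j s'" if "j \<in> J" and eq: "\<And>i. i \<in> D j \<Longrightarrow> s i = s' i" for j s s'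
    proof -
      obtain I I' \<sigma> where j: "j = (I, I', \<sigma>)" by (cases j)
      have "pt s i = pt s' i" if "i \<in> I \<union> I'" for i
        using eq[of i] that by (auto simp: pt_def D_def j)
      then have "pt s ` I = pt s' ` I" "pt s ` I' = pt s' ` I'" by (auto intro!: image_cong)
      then show ?thesis by (simp add: \<Phi>_def j)
    qed
    have "real (card J) * (1 - 1 / (4 * real k ^ 2)) ^ (m - 2 * k)
        \<le> real (2 * ((M + 1) ^ k) ^ 2) * (1 - 1 / (4 * real k ^ 2)) ^ (m - 2 * k)"
      by (intro mult_right_mono of_nat_mono cardJ zero_le_power) (use \<epsilon> in simp)
    also have "\<dots> < 1" using sample_size_suffices[OF k(1)] by (simp add: M_def m_def)
    finally show "real (card J) * (1 - 1 / (4 * real k ^ 2)) ^ (m - 2 * k) < 1" .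
  qed (use \<epsilon> in auto)
  then obtain s where s: "\<forall>i<m. s i \<in> V" and net:
    "\<forall>j\<in>J. (\<forall>i<m. s i \<notin> \<Phi> j s) \<longrightarrow> real (card (\<Phi> j s \<inter> V)) \<le> 1 / (4 * real k ^ 2) * card V"
    by (elim exE conjE)
  define N where "N = pt s ` {..<M}"
  have NV: "N \<subseteq> V"
  proof -
    have "pt s i \<in> V" for i using s v0 E(1) es(1) nth_mem[of "i - m" es] by (auto simp: pt_def)
    then show ?thesis by (auto simp: N_def)
  qed
  have "E \<subseteq> N"
  proof
    fix x assume "x \<in> E"
    then obtain i where "i < length es" "x = es ! i" using es(1) by (metis in_set_conv_nth)
    then have "x = pt s (m + i)" "m + i < M" using es(2) cardE(2) by (auto simp: pt_def M_def)
    then show "x \<in> N" by (auto simp: N_def)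
  qed
  then have spanN: "V \<subseteq> span N" using E(3) span_mono by blast
  have cardN: "card N \<le> M" unfolding N_def using card_image_le[of "{..<M}" "pt s"] by simp
  have "real (card {v\<in>V. \<sigma> * (?w A v * ?w A' v) < 0}) \<le> 1 / (4 * real k ^ 2) * card V"
    if A: "A \<subseteq> N" "A' \<subseteq> N" "\<sigma> \<in> {1,-1}" "card A \<le> k" "card A' \<le> k"
      and none: "\<forall>p\<in>N. \<not> \<sigma> * (?w A p * ?w A' p) < 0" for A A' \<sigma>
  proof -
    have "\<exists>I\<in>\<I>. pt s ` I = A" if AN: "A \<subseteq> N" "card A \<le> k" for A
    proof -
      \<comment> \<open>Sample points may repeat; an index set on which \<open>pt s\<close> is
        injective is no larger than \<open>A\<close>.\<close>
      obtain I where "I \<subseteq> {..<M}" "inj_on (pt s) I" "A = pt s ` I"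
        using subset_image_inj[of A "pt s" "{..<M}"] AN(1) by (auto simp: N_def)
      then show ?thesis using AN(2) by (auto simp: \<I>_def card_image intro!: bexI[of _ I])
    qed
    note pre = this
    obtain I where I1: "I \<in> \<I>" "pt s ` I = A" using pre[OF A(1,4)] by (elim bexE)
    obtain I' where I2: "I' \<in> \<I>" "pt s ` I' = A'" using pre[OF A(2,5)] by (elim bexE)
    note I = I1 I2
    define j where "j = (I, I', \<sigma>)"
    have \<Phi>j: "\<Phi> j s = {v\<in>V. \<sigma> * (?w A v * ?w A' v) < 0}" by (simp add: \<Phi>_def j_def I)
    have out: "s i \<notin> \<Phi> j s" if "i < m" for i
    proof -
      have "pt s i \<in> N" using that unfolding N_def M_def by (intro imageI) simp
      then have "s i \<in> N" using that by (simp add: pt_def)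
      then show ?thesis using none unfolding \<Phi>j by blast
    qed
    have "j \<in> J" using I A(3) by (simp add: J_def j_def)
    with net out have "real (card (\<Phi> j s \<inter> V)) \<le> 1 / (4 * real k ^ 2) * card V" by simp
    moreover have "\<Phi> j s \<inter> V = \<Phi> j s" unfolding \<Phi>j by blast
    ultimately show ?thesis unfolding \<Phi>j by simp
  qed
  then show ?thesis
    using NV spanN cardN unfolding M_def m_def by (intro exI[of _ N]) simp
qed

text \<open>A container is the set of points at which some ray of positive weight is positive. Its
  excess over the halfspace is covered by the at most \<open>k^2\<close> sets of points separated by
  two of the rays, each of size at most \<open>card V / (4 k^2)\<close>. The three factors in the
  bound count traces, lists of points encoding the rays, and subsets of the rays.\<close>

lemma halfspace_containers_nonempty:
  fixes V :: "'a::real_vector set"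
  assumes V: "finite V" "V \<noteq> {}" and k: "k \<ge> 1" "finite B" "card B \<le> k" "V \<subseteq> span B"
  shows "\<exists>F. finite F \<and> card F \<le> ((128 * k ^ 4) ^ k) ^ 2 * 2 ^ k \<and>
    (\<forall>f::'a \<Rightarrow> real. linear f \<longrightarrow> (\<exists>c\<in>F. {v\<in>V. f v > 0} \<subseteq> c \<and> c \<subseteq> V \<and>
       4 * card c \<le> 4 * card {v\<in>V. f v > 0} + card V))"
proof -
  obtain N where N: "N \<subseteq> V" "V \<subseteq> span N" "card N \<le> 104 * k ^ 4 + k" and net:
    "\<forall>A\<subseteq>N. \<forall>A'\<subseteq>N. \<forall>\<sigma>\<in>{1,-1}. card A \<le> k \<longrightarrow> card A' \<le> k \<longrightarrow>
      (\<forall>p\<in>N. \<not> \<sigma> * (vanishing_functional V A p * vanishing_functional V A' p) < 0) \<longrightarrow>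
      real (card {v\<in>V. \<sigma> * (vanishing_functional V A v * vanishing_functional V A' v) < 0})
        \<le> 1 / (4 * real k ^ 2) * card V"
    using separation_net[OF assms] by (elim exE conjE)
  have finN: "finite N" using N(1) V(1) finite_subset by blast
  have NB: "N \<subseteq> span B" using N(1) k(4) by blast
  note hyps = finN N(1,2) k(2,3) NB
  define traces where "traces = {halfspace_trace N f | f. linear f}"
  define lists where "lists = {ps. set ps \<subseteq> N \<and> length ps \<le> k}"
  define \<rho> where "\<rho> = extreme_ray V N k"
  define cont where "cont = (\<lambda>R. {v\<in>V. \<exists>r\<in>R. r v > (0::real)})"
  define rays where "rays = (\<lambda>(T, ps). ray_set (\<rho> T) {} ps)"
  define F where "F = (\<Union>x\<in>traces \<times> lists. cont ` Pow (rays x))"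
  have "traces \<subseteq> Pow N" by (auto simp: traces_def halfspace_trace_def)
  then have fintr: "finite traces" using finN finite_subset[of traces "Pow N"] by simp
  have finli: "finite lists" using bounded_lists[OF finN, of k] by (simp add: lists_def)
  have bound: "card N + 1 \<le> 128 * k ^ 4"
  proof -
    have "k \<le> k ^ 4" "1 \<le> k ^ 4" using k(1) by (simp_all add: self_le_power)
    then show ?thesis using N(3) by linarith
  qed
  then have bk: "(card N + 1) ^ k \<le> (128 * k ^ 4) ^ k" by (rule power_mono) simp
  have "card traces \<le> (128 * k ^ 4) ^ k"
    using card_halfspace_traces_le[OF finN k(2,3) NB] bk by (simp add: traces_def)
  moreover have "card lists \<le> (128 * k ^ 4) ^ k"
    using bounded_lists[OF finN, of k] bk unfolding lists_def by linarith
  ultimately have cardTL: "card (traces \<times> lists) \<le> ((128 * k ^ 4) ^ k) ^ 2"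
    by (simp add: card_cartesian_product power2_eq_square mult_le_mono del: power_mult_distrib)
  have fibre: "finite (cont ` Pow (rays x)) \<and> card (cont ` Pow (rays x)) \<le> 2 ^ k"
    if xin: "x \<in> traces \<times> lists" for x
  proof -
    obtain T ps where x: "x = (T, ps)" "length ps \<le> k" using xin by (auto simp: lists_def)
    have fin: "finite (rays x)" "card (rays x) \<le> k"
      using ray_set_bound[of "\<rho> T" "{}" ps] x by (auto simp: rays_def)
    have "card (cont ` Pow (rays x)) \<le> card (Pow (rays x))" by (rule card_image_le) (use fin in simp)
    also have "\<dots> = 2 ^ card (rays x)" by (rule card_Pow[OF fin(1)])
    also have "\<dots> \<le> 2 ^ k" using fin(2) by (intro power_increasing) auto
    finally show ?thesis using fin(1) by simp
  qed
  have "card F \<le> (\<Sum>x\<in>traces \<times> lists. card (cont ` Pow (rays x)))"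
    unfolding F_def by (rule card_UN_le) (use fintr finli in simp)
  also have "\<dots> \<le> card (traces \<times> lists) * 2 ^ k"
    using sum_bounded_above[of "traces \<times> lists" "\<lambda>x. card (cont ` Pow (rays x))" "2 ^ k"] fibre by simp
  finally have cardF: "card F \<le> ((128 * k ^ 4) ^ k) ^ 2 * 2 ^ k"
    using cardTL by (meson le_trans mult_le_mono1)
  have finF: "finite F" unfolding F_def using fintr finli fibre by (intro finite_UN_I) auto
  have "\<exists>c\<in>F. {v\<in>V. f v > 0} \<subseteq> c \<and> c \<subseteq> V \<and> 4 * card c \<le> 4 * card {v\<in>V. f v > 0} + card V"
    if f: "linear f" for f :: "'a \<Rightarrow> real"
  proof -
    define T where "T = halfspace_trace N f"
    have "f \<in> dual_face N T {}" using f by (auto simp: dual_face_def T_def halfspace_trace_def)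
    then have "\<exists>ps t. set ps \<subseteq> N \<and> length ps \<le> k \<and> (\<forall>r. t r \<ge> 0) \<and>
      (\<forall>v\<in>V. f v = (\<Sum>r\<in>ray_set (\<rho> T) {} ps. t r * r v)) \<and>
      (\<forall>r\<in>ray_set (\<rho> T) {} ps. r \<in> dual_face N T {} \<and>
       (\<exists>A\<subseteq>N. card A \<le> k \<and> (\<exists>s\<in>{1,-1}. r = (\<lambda>p. s * vanishing_functional V A p))))"
      unfolding \<rho>_def by (intro dual_face_decomposition[OF hyps]) (auto simp: independent_empty)
    then obtain ps t where ps: "set ps \<subseteq> N" "length ps \<le> k" and t: "\<forall>r. t r \<ge> 0"
      and ft: "\<forall>v\<in>V. f v = (\<Sum>r\<in>ray_set (\<rho> T) {} ps. t r * r v)"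
      and rays: "\<forall>r\<in>ray_set (\<rho> T) {} ps. r \<in> dual_face N T {} \<and>
       (\<exists>A\<subseteq>N. card A \<le> k \<and> (\<exists>s\<in>{1,-1}. r = (\<lambda>p. s * vanishing_functional V A p)))"
      by (elim exE conjE) (rule that; assumption)
    define R0 where "R0 = ray_set (\<rho> T) {} ps"
    \<comment> \<open>Rays of weight zero could be positive far outside the halfspace without
      contributing to \<open>f\<close>, so they are dropped. Recording which rays remain costs the
      factor \<open>2 ^ k\<close>.\<close>
    define R where "R = {r \<in> R0. t r > 0}"
    have R0: "finite R0" "card R0 \<le> k" using ray_set_bound[of "\<rho> T" "{}" ps] ps(2) by (auto simp: R0_def)
    have "card R \<le> card R0" by (rule card_mono[OF R0(1)]) (simp add: R_def)
    then have R: "finite R" "card R \<le> k" using R0 by (auto simp: R_def)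
    have fR: "f v = (\<Sum>r\<in>R. t r * r v)" if "v \<in> V" for v
    proof -
      have "f v = (\<Sum>r\<in>R0. t r * r v)" using ft that by (simp add: R0_def)
      also have "\<dots> = (\<Sum>r\<in>R. t r * r v)"
      proof (rule sum.mono_neutral_right[OF R0(1)])
        have "t r = 0" if "r \<in> R0 - R" for r
          using t[rule_format, of r] that by (simp add: R_def)
        then show "\<forall>r\<in>R0 - R. t r * r v = 0" by simp
      qed (simp add: R_def)
      finally show ?thesis .
    qed
    define H where "H = {v\<in>V. f v > 0}"
    have HR: "H \<subseteq> cont R"
    proof
      fix v assume v: "v \<in> H"
      show "v \<in> cont R"
      proof (rule ccontr)
        assume "v \<notin> cont R"
        then have "r v \<le> 0" if "r \<in> R" for r using that v by (force simp: cont_def H_def)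
        then have "(\<Sum>r\<in>R. t r * r v) \<le> 0" using t by (intro sum_nonpos mult_nonneg_nonpos) auto
        then show False using v fR[of v] by (simp add: H_def)
      qed
    qed
    define X where "X = (\<lambda>(r, r'). {v\<in>V. r v * r' v < (0::real)})"
    \<comment> \<open>At such a point \<open>f\<close> is not positive although one weighted ray is,
      so another ray is negative there.\<close>
    have "cont R - H \<subseteq> (\<Union>x\<in>R \<times> R. X x)"
    proof
      fix v assume v: "v \<in> cont R - H"
      then obtain r where r: "r \<in> R" "r v > 0" "v \<in> V" by (auto simp: cont_def)
      have "\<exists>r'\<in>R. r' v < 0"
      proof (rule ccontr)
        assume "\<not> (\<exists>r'\<in>R. r' v < 0)"
        then have nn: "r' v \<ge> 0" if "r' \<in> R" for r' using that by force
        have "0 < t r * r v" using r by (simp add: R_def)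
        then have "0 < (\<Sum>r\<in>R. t r * r v)"
          by (rule sum_pos2[OF R(1) r(1)]) (use nn t in simp)
        then show False using v r(3) fR[of v] by (simp add: H_def)
      qed
      then obtain r' where "r' \<in> R" "r' v < 0" by blast
      then show "v \<in> (\<Union>x\<in>R \<times> R. X x)"
        using r by (intro UN_I[of "(r, r')"]) (auto simp: X_def mult_pos_neg)
    qed
    then have "card (cont R - H) \<le> card (\<Union>x\<in>R \<times> R. X x)"
      by (rule card_mono[rotated]) (use R(1) V(1) in \<open>auto simp: X_def\<close>)
    also have "\<dots> \<le> (\<Sum>x\<in>R \<times> R. card (X x))" by (rule card_UN_le) (use R in simp)
    finally have "real (card (cont R - H)) \<le> (\<Sum>x\<in>R \<times> R. real (card (X x)))"
      by (simp flip: of_nat_sum)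
    also have "\<dots> \<le> (\<Sum>x\<in>R \<times> R. 1 / (4 * real k ^ 2) * card V)"
    proof (rule sum_mono)
      fix x assume "x \<in> R \<times> R"
      then obtain r r' where x: "x = (r, r')" "r \<in> R0" "r' \<in> R0" by (auto simp: R_def)
      obtain A s where A: "A \<subseteq> N" "card A \<le> k" "s \<in> {1,-1::real}"
        "r = (\<lambda>p. s * vanishing_functional V A p)"
        using rays[rule_format, OF x(2)[unfolded R0_def]] by (elim exE conjE bexE)
      obtain A' s' where A': "A' \<subseteq> N" "card A' \<le> k" "s' \<in> {1,-1::real}"
        "r' = (\<lambda>p. s' * vanishing_functional V A' p)"
        using rays[rule_format, OF x(3)[unfolded R0_def]] by (elim exE conjE bexE)
      have prod: "r v * r' v = s * s' * (vanishing_functional V A v * vanishing_functional V A' v)" for v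
        by (simp add: A(4) A'(4))
      \<comment> \<open>Both rays obey the sign pattern \<open>T\<close>, so they separate no point
        of \<open>N\<close>.\<close>
      have "\<not> r p * r' p < 0" if "p \<in> N" for p
      proof -
        have "r \<in> dual_face N T {}" "r' \<in> dual_face N T {}" using rays x by (simp_all add: R0_def)
        then have "if p \<in> T then r p \<ge> 0 else r p \<le> 0" "if p \<in> T then r' p \<ge> 0 else r' p \<le> 0"
          using that by (simp_all add: dual_face_def)
        then have "r p * r' p \<ge> 0" by (cases "p \<in> T") (auto intro: mult_nonpos_nonpos)
        then show ?thesis by simp
      qed
      then have "\<forall>p\<in>N. \<not> s * s' * (vanishing_functional V A p * vanishing_functional V A' p) < 0"
        unfolding prod by blast
      moreover have "s * s' \<in> {1,-1}" using A(3) A'(3) by auto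
      ultimately show "real (card (X x)) \<le> 1 / (4 * real k ^ 2) * card V"
        using net[rule_format, OF A(1) A'(1) _ A(2) A'(2), of "s * s'"]
        unfolding x(1) X_def prod prod.case by fastforce
    qed
    also have "\<dots> = real (card R * card R) * (1 / (4 * real k ^ 2) * card V)"
      by (simp add: card_cartesian_product)
    also have "\<dots> \<le> real (k * k) * (1 / (4 * real k ^ 2) * card V)"
      by (intro mult_right_mono of_nat_mono mult_le_mono R(2)) simp
    also have "\<dots> = card V / 4" using k(1) by (simp add: power2_eq_square)
    finally have "4 * card (cont R - H) \<le> card V" by linarith
    moreover have "card (cont R) \<le> card H + card (cont R - H)"
    proof -
      have "card (cont R) \<le> card (H \<union> (cont R - H))"
        by (rule card_mono) (use V(1) in \<open>auto simp: cont_def H_def\<close>)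
      also have "\<dots> \<le> card H + card (cont R - H)" by (rule card_Un_le)
      finally show ?thesis .
    qed
    ultimately have "4 * card (cont R) \<le> 4 * card H + card V" by linarith
    moreover have "cont R \<in> F"
    proof -
      have "(T, ps) \<in> traces \<times> lists" using f ps by (auto simp: traces_def lists_def T_def)
      moreover have "R \<in> Pow (rays (T, ps))" by (auto simp: rays_def R_def R0_def)
      ultimately show ?thesis unfolding F_def by (intro UN_I imageI)
    qed
    moreover have "cont R \<subseteq> V" by (auto simp: cont_def)
    ultimately show ?thesis using HR unfolding H_def by (intro bexI[of _ "cont R"] conjI)
  qed
  then show ?thesis using finF cardF by (intro exI[of _ F]) simp
qed

text \<open>The empty case matters because the witnesses may be exhausted before the last round of
  the protocol.\<close>

lemma halfspace_containers:
  fixes V :: "'a::real_vector set"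
  assumes V: "finite V" and k: "k \<ge> 1" "finite B" "card B \<le> k" "V \<subseteq> span B"
  shows "\<exists>F. finite F \<and> card F \<le> ((128 * k ^ 4) ^ k) ^ 2 * 2 ^ k \<and>
    (\<forall>f::'a \<Rightarrow> real. linear f \<longrightarrow> (\<exists>c\<in>F. {v\<in>V. f v > 0} \<subseteq> c \<and> c \<subseteq> V \<and>
       4 * card c \<le> 4 * card {v\<in>V. f v > 0} + card V))"
proof (cases "V = {}")
  case True
  have "0 < ((128 * k ^ 4) ^ k) ^ 2 * (2::nat) ^ k" using k(1) by simp
  then have "1 \<le> ((128 * k ^ 4) ^ k) ^ 2 * (2::nat) ^ k" by linarith
  moreover have "card {{}::'a set} = 1" by simp
  ultimately have "card {{}::'a set} \<le> ((128 * k ^ 4) ^ k) ^ 2 * 2 ^ k" by (simp only:)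
  then show ?thesis using True by (intro exI[of _ "{{}}"]) (simp del: power_mult_distrib)
next
  case False
  then show ?thesis by (rule halfspace_containers_nonempty[OF V _ k])
qed

section \<open>Separation and Caratheodory's theorem in real vector spaces\<close>

text \<open>As \<open>\<delta>\<close> tends to 0 from the right, each expression tends to
  \<open>F x > 0\<close>, and finitely many such conditions hold simultaneously.\<close>

lemma eventually_positive_perturbation:
  fixes F G :: "'a \<Rightarrow> real"
  assumes "finite S" "\<And>x. x \<in> S \<Longrightarrow> F x > 0"
  shows "\<exists>\<delta>>0. \<forall>x\<in>S. F x + \<delta> * G x > 0"
proof -
  have "\<forall>x\<in>S. eventually (\<lambda>\<delta>. F x + \<delta> * G x > 0) (at_right 0)"
  proof
    fix x assume "x \<in> S"
    have "((\<lambda>\<delta>. F x + \<delta> * G x) \<longlongrightarrow> F x + 0 * G x) (at_right 0)" by (intro tendsto_intros)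
    then show "eventually (\<lambda>\<delta>. F x + \<delta> * G x > 0) (at_right 0)"
      using order_tendstoD(1) assms(2)[OF \<open>x \<in> S\<close>] by fastforce
  qed
  then have "eventually (\<lambda>\<delta>. \<forall>x\<in>S. F x + \<delta> * G x > 0) (at_right 0)"
    by (rule eventually_ball_finite[OF assms(1)])
  then have "eventually (\<lambda>\<delta>. \<delta> > 0 \<and> (\<forall>x\<in>S. F x + \<delta> * G x > 0)) (at_right 0)"
    using eventually_at_right_less[of "0::real"] by eventually_elim simp
  then have "\<exists>\<delta>. \<delta> > 0 \<and> (\<forall>x\<in>S. F x + \<delta> * G x > 0)"
    by (rule eventually_happens'[rotated]) simp
  then show ?thesis by simp
qed

lemma linear_pos_on_convex_hull:
  fixes f :: "'a::real_vector \<Rightarrow> real"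
  assumes f: "linear f" and pos: "\<And>x. x \<in> S \<Longrightarrow> f x > 0" and z: "z \<in> convex hull S"
  shows "f z > 0"
proof -
  have "f ` (convex hull S) = convex hull (f ` S)" by (rule convex_hull_linear_image[OF f])
  moreover have "convex hull (f ` S) \<subseteq> {0<..}"
    by (rule hull_minimal) (use pos in \<open>auto intro: convex_real_interval\<close>)
  ultimately show ?thesis using z by auto
qed

text \<open>Gordan's alternative. If a functional \<open>f\<close> positive on \<open>S - {s}\<close> is negative at \<open>s\<close>, project the
  other points along \<open>s\<close> onto the kernel of \<open>f\<close>; a functional positive on the projections is corrected
  by a small multiple of \<open>f\<close>.\<close>

lemma gordan_positive_functional:
  fixes S :: "'a::real_vector set"
  assumes "finite S" "0 \<notin> convex hull S"
  shows "\<exists>f::'a \<Rightarrow> real. linear f \<and> (\<forall>s\<in>S. f s > 0)"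
  using assms
proof (induction "card S" arbitrary: S rule: less_induct)
  case (less S)
  show ?case
  proof (cases "S = {}")
    case True
    have "linear (\<lambda>_::'a. 0::real)" by (rule linear_zero)
    then show ?thesis using True by auto
  next
    case False
    then obtain s where s: "s \<in> S" by blast
    define S' where "S' = S - {s}"
    have S': "finite S'" "S = insert s S'" using less.prems s by (auto simp: S'_def)
    have cardS': "card S' < card S" unfolding S'_def by (rule card_Diff1_less[OF less.prems(1) s])
    have "0 \<notin> convex hull S'" using less.prems(2) hull_mono[of S' S] S'(2) by blast
    then obtain f :: "'a \<Rightarrow> real" where f: "linear f" "\<forall>x\<in>S'. f x > 0"
      using less.hyps[OF cardS' S'(1)] by blast
    have s0: "s \<noteq> 0" using less.prems(2) s hull_inc[of s S] by auto
    consider "f s > 0" | "f s = 0" | "f s < 0" by linarith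
    then show ?thesis
    proof cases
      case 1
      then show ?thesis using f S'(2) by (intro exI[of _ f]) auto
    next
      case 2
      \<comment> \<open>\<open>f\<close> fails only at \<open>s\<close>, where it is zero; a small
        multiple of a functional that is 1 at \<open>s\<close> repairs this.\<close>
      have "independent {s}" using s0 by simp
      then obtain g :: "'a \<Rightarrow> real" where g: "linear g" "g s = 1"
        using linear_independent_extend[of "{s}" "\<lambda>_. 1::real"] by auto
      obtain \<delta> where \<delta>: "\<delta> > 0" "\<forall>x\<in>S'. f x + \<delta> * g x > 0"
        using eventually_positive_perturbation[OF S'(1), of f g] f(2) by auto
      have "linear (\<lambda>x. 1 * f x + \<delta> * g x)" by (rule linear_lincomb_real[OF f(1) g(1)])
      then show ?thesis using \<delta> 2 g(2) S'(2) by (intro exI[of _ "\<lambda>x. 1 * f x + \<delta> * g x"]) auto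
    next
      case 3
      define \<pi> where "\<pi> = (\<lambda>x. x - (f x / f s) *\<^sub>R s)"
      have lin: "linear \<pi>"
        unfolding \<pi>_def
        by (rule linearI) (simp_all add: linear_add[OF f(1)] linear_scale[OF f(1)] algebra_simps add_divide_distrib)
      have "0 \<notin> convex hull (\<pi> ` S')"
      proof
        assume "0 \<in> convex hull (\<pi> ` S')"
        then obtain z where z: "z \<in> convex hull S'" "\<pi> z = 0"
          using convex_hull_linear_image[OF lin, of S'] by (metis imageE)
        have fz: "f z > 0" using linear_pos_on_convex_hull[OF f(1) _ z(1)] f(2) by blast
        \<comment> \<open>A vanishing projection says \<open>z + c *\<^sub>R s = 0\<close> with
          \<open>c > 0\<close>; division by \<open>1 + c\<close> exhibits 0 as a convex combination
          from \<open>S\<close>.\<close>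
        define c where "c = - (f z / f s)"
        have c: "c > 0" using fz 3 by (simp add: c_def divide_pos_neg)
        have zc: "z + c *\<^sub>R s = 0" using z(2) by (simp add: \<pi>_def c_def)
        have "z \<in> convex hull S" "s \<in> convex hull S"
          using z(1) hull_mono[of S' S] S'(2) hull_inc[of s S] by auto
        then have "(1 / (1 + c)) *\<^sub>R z + (c / (1 + c)) *\<^sub>R s \<in> convex hull S"
          using c by (intro convexD[OF convex_convex_hull]) (auto simp: add_divide_distrib[symmetric])
        moreover have "(1 / (1 + c)) *\<^sub>R z + (c / (1 + c)) *\<^sub>R s = (1 / (1 + c)) *\<^sub>R (z + c *\<^sub>R s)"
          by (simp add: scaleR_add_right)
        ultimately show False using less.prems(2) zc by simp
      qed
      moreover have "card (\<pi> ` S') < card S" using card_image_le[OF S'(1), of \<pi>] cardS' by linarith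
      ultimately have "\<exists>g::'a \<Rightarrow> real. linear g \<and> (\<forall>x\<in>\<pi> ` S'. g x > 0)"
        using less.hyps[of "\<pi> ` S'"] S'(1) by blast
      then obtain g :: "'a \<Rightarrow> real" where g: "linear g" "\<forall>x\<in>S'. g (\<pi> x) > 0" by auto
      \<comment> \<open>The correction \<open>f x / f s\<close> is 1 at \<open>s\<close>, where
        \<open>g (\<pi> s) = 0\<close>.\<close>
      obtain \<delta> where \<delta>: "\<delta> > 0" "\<forall>x\<in>S'. g (\<pi> x) + \<delta> * (f x / f s) > 0"
        using eventually_positive_perturbation[OF S'(1), of "\<lambda>x. g (\<pi> x)" "\<lambda>x. f x / f s"] g(2) by auto
      have "linear (g \<circ> \<pi>)" by (rule linear_compose[OF lin g(1)])
      then have "linear (\<lambda>x. 1 * (g \<circ> \<pi>) x + \<delta> / f s * f x)"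
        by (rule linear_lincomb_real[OF _ f(1)])
      moreover have "\<pi> s = 0" using 3 by (simp add: \<pi>_def)
      then have "1 * (g \<circ> \<pi>) s + \<delta> / f s * f s > 0" using \<delta>(1) 3 linear_0[OF g(1)] by simp
      ultimately show ?thesis
        using \<delta>(2) S'(2) by (intro exI[of _ "\<lambda>x. 1 * (g \<circ> \<pi>) x + \<delta> / f s * f x"]) auto
    qed
  qed
qed

text \<open>Gordan's alternative is applied to the points \<open>(x, 1)\<close> and
  \<open>(- y, -1)\<close>. If 0 were a convex combination of them, the last coordinate would give
  each side weight 1/2, and doubling the weights would yield a common point of the hulls.\<close>

lemma separating_functional:
  fixes X Y :: "'a::real_vector set"
  assumes fin: "finite X" "finite Y" and disj: "convex hull X \<inter> convex hull Y = {}"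
  shows "\<exists>f::'a \<times> real \<Rightarrow> real. linear f \<and> (\<forall>x\<in>X. f (x, 1) > 0) \<and> (\<forall>y\<in>Y. f (y, 1) < 0)"
proof -
  define S1 where "S1 = (\<lambda>x::'a. (x, 1::real)) ` X"
  define S2 where "S2 = (\<lambda>y::'a. (- y, -1::real)) ` Y"
  have fS: "finite S1" "finite S2" using fin by (auto simp: S1_def S2_def)
  have nz: "0 \<notin> convex hull (S1 \<union> S2)"
  proof
    assume "0 \<in> convex hull (S1 \<union> S2)"
    then obtain u where u: "\<forall>x\<in>S1 \<union> S2. 0 \<le> u x" "sum u (S1 \<union> S2) = 1" "(\<Sum>x\<in>S1 \<union> S2. u x *\<^sub>R x) = 0"
      using fS by (auto simp: convex_hull_finite)
    define a where "a = (\<lambda>x. u (x, 1))"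
    define b where "b = (\<lambda>y. u (- y, -1))"
    have dS: "S1 \<inter> S2 = {}" by (auto simp: S1_def S2_def)
    have inj1: "inj_on (\<lambda>x::'a. (x, 1::real)) X" and inj2: "inj_on (\<lambda>y::'a. (- y, -1::real)) Y"
      by (auto simp: inj_on_def)
    have "sum u (S1 \<union> S2) = sum a X + sum b Y"
      unfolding sum.union_disjoint[OF fS dS] unfolding S1_def S2_def
      by (simp add: sum.reindex[OF inj1] sum.reindex[OF inj2] a_def b_def)
    then have ab1: "sum a X + sum b Y = 1" using u(2) by simp
    have "(\<Sum>x\<in>S1 \<union> S2. u x *\<^sub>R x) = (\<Sum>x\<in>X. a x *\<^sub>R (x, 1)) + (\<Sum>y\<in>Y. b y *\<^sub>R (- y, -1))"
      unfolding sum.union_disjoint[OF fS dS] unfolding S1_def S2_def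
      by (simp add: sum.reindex[OF inj1] sum.reindex[OF inj2] a_def b_def)
    then have z: "(\<Sum>x\<in>X. a x *\<^sub>R (x, 1::real)) + (\<Sum>y\<in>Y. b y *\<^sub>R (- y, -1)) = 0" using u(3) by simp
    have "snd ((\<Sum>x\<in>X. a x *\<^sub>R (x, 1::real)) + (\<Sum>y\<in>Y. b y *\<^sub>R (- y, -1))) = sum a X - sum b Y"
      by (simp add: snd_sum sum_negf)
    then have "sum a X = sum b Y" unfolding z by simp
    then have half: "sum a X = 1/2" "sum b Y = 1/2" using ab1 by auto
    have "fst ((\<Sum>x\<in>X. a x *\<^sub>R (x, 1::real)) + (\<Sum>y\<in>Y. b y *\<^sub>R (- y, -1))) =
        (\<Sum>x\<in>X. a x *\<^sub>R x) - (\<Sum>y\<in>Y. b y *\<^sub>R y)"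
      by (simp add: fst_sum sum_negf)
    then have eq: "(\<Sum>x\<in>X. a x *\<^sub>R x) = (\<Sum>y\<in>Y. b y *\<^sub>R y)" unfolding z by simp
    have nn: "\<forall>x\<in>X. 0 \<le> a x" "\<forall>y\<in>Y. 0 \<le> b y" using u(1) by (auto simp: a_def b_def S1_def S2_def)
    have "(\<Sum>x\<in>X. (2 * a x) *\<^sub>R x) \<in> convex hull X"
      by (rule convex_sum[OF fin(1) convex_convex_hull])
        (use half nn in \<open>auto simp: hull_inc simp flip: sum_distrib_left\<close>)
    moreover have "(\<Sum>y\<in>Y. (2 * b y) *\<^sub>R y) \<in> convex hull Y"
      by (rule convex_sum[OF fin(2) convex_convex_hull])
        (use half nn in \<open>auto simp: hull_inc simp flip: sum_distrib_left\<close>)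
    moreover have "(\<Sum>x\<in>X. (2 * a x) *\<^sub>R x) = (\<Sum>y\<in>Y. (2 * b y) *\<^sub>R y)"
      using eq by (simp flip: scaleR_scaleR scaleR_sum_right)
    ultimately show False using disj by (metis disjoint_iff)
  qed
  then obtain f :: "'a \<times> real \<Rightarrow> real" where f: "linear f" "\<forall>s\<in>S1 \<union> S2. f s > 0"
    using gordan_positive_functional[OF finite_UnI[OF fS] nz] by (elim exE conjE)
  have "f (y, 1) < 0" if "y \<in> Y" for y
  proof -
    have "f (- y, -1) = - f (y, 1)" using linear_neg[OF f(1), of "(y, 1)"] by simp
    then show ?thesis using f(2) that by (force simp: S2_def)
  qed
  then show ?thesis using f by (intro exI[of _ f]) (auto simp: S1_def)
qed

text \<open>The lift to height 1 turns affine dependences into linear ones. If a set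
  \<open>A\<close> of least size had more than \<open>k\<close> points, shifting the weights along a
  dependence until one of them vanishes would give a smaller set.\<close>

lemma caratheodory_lifted:
  fixes X :: "'a::real_vector set"
  assumes X: "finite X" and B: "finite B" "card B \<le> k" "(\<lambda>x. (x, 1::real)) ` X \<subseteq> span B"
    and p: "p \<in> convex hull X"
  shows "\<exists>A\<subseteq>X. card A \<le> k \<and> p \<in> convex hull A"
proof -
  obtain A where A: "A \<subseteq> X" "p \<in> convex hull A"
    and Amin: "\<And>A'. A' \<subseteq> X \<Longrightarrow> p \<in> convex hull A' \<Longrightarrow> card A \<le> card A'"
    using ex_has_least_nat[of "\<lambda>A. A \<subseteq> X \<and> p \<in> convex hull A" X card] p by auto
  have finA: "finite A" using A(1) X finite_subset by blast
  have "card A \<le> k"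
  proof (rule ccontr)
    assume big: "\<not> card A \<le> k"
    let ?L = "\<lambda>x::'a. (x, 1::real)"
    have inj: "inj_on ?L A" by (auto simp: inj_on_def)
    have "\<not> independent (?L ` A)"
    proof
      assume i: "independent (?L ` A)"
      have "?L ` A \<subseteq> span B" using A(1) B(3) by blast
      then have "card (?L ` A) \<le> card B" using independent_span_bound[OF B(1) i] by blast
      then show False using big B(2) card_image[OF inj] by simp
    qed
    then obtain u v where uv: "v \<in> ?L ` A" "u v \<noteq> 0" "(\<Sum>v\<in>?L ` A. u v *\<^sub>R v) = 0"
      using dependent_finite[of "?L ` A"] finA by auto
    define c where "c = (\<lambda>x. u (x, 1))"
    have "(\<Sum>x\<in>A. c x *\<^sub>R (x, 1::real)) = 0" using uv(3) by (simp add: sum.reindex[OF inj] c_def)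
    then have "fst (\<Sum>x\<in>A. c x *\<^sub>R (x, 1::real)) = 0" "snd (\<Sum>x\<in>A. c x *\<^sub>R (x, 1::real)) = 0"
      by simp_all
    then have c0: "(\<Sum>x\<in>A. c x *\<^sub>R x) = 0" "sum c A = 0" by (simp_all add: fst_sum snd_sum)
    obtain a0 where "a0 \<in> A" "c a0 \<noteq> 0" using uv(1,2) by (auto simp: c_def)
    have "\<exists>a\<in>A. c a > 0"
    proof (rule ccontr)
      assume "\<not> (\<exists>a\<in>A. c a > 0)"
      then have "\<forall>a\<in>A. 0 \<le> - c a" by force
      moreover have "(\<Sum>a\<in>A. - c a) = 0" using c0(2) by (simp add: sum_negf)
      ultimately have "\<forall>a\<in>A. - c a = 0" using sum_nonneg_eq_0_iff[OF finA, of "\<lambda>a. - c a"] by blast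
      then show False using \<open>a0 \<in> A\<close> \<open>c a0 \<noteq> 0\<close> by auto
    qed
    then have ne: "{a\<in>A. c a > 0} \<noteq> {}" by blast
    obtain w where w: "\<forall>x\<in>A. 0 \<le> w x" "sum w A = 1" "(\<Sum>x\<in>A. w x *\<^sub>R x) = p"
      using A(2) finA by (auto simp: convex_hull_finite)
    obtain a1 where a1: "a1 \<in> A" "c a1 > 0"
      and a1min: "\<And>a. a \<in> A \<Longrightarrow> c a > 0 \<Longrightarrow> w a1 / c a1 \<le> w a / c a"
      using ex_is_arg_min_if_finite[OF _ ne, of "\<lambda>a. w a / c a"] finA by (auto simp: is_arg_min_linorder)
    \<comment> \<open>The least ratio over the positive coefficients keeps all weights nonnegative
      and makes that of \<open>a1\<close> zero.\<close>
    define t where "t = w a1 / c a1"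
    have t0: "t \<ge> 0" using w(1) a1 by (simp add: t_def)
    define w' where "w' = (\<lambda>x. w x - t * c x)"
    have w'0: "0 \<le> w' x" if "x \<in> A" for x
    proof (cases "c x > 0")
      case True
      then have "t \<le> w x / c x" using a1min[OF that] by (simp add: t_def)
      then show ?thesis using True by (simp add: w'_def pos_le_divide_eq)
    next
      case False
      then have "t * c x \<le> 0" using t0 by (simp add: mult_nonneg_nonpos)
      then show ?thesis using w(1) that by (force simp: w'_def)
    qed
    have w'1: "w' a1 = 0" using a1 by (simp add: w'_def t_def)
    have "sum w' A = 1"
      using w(2) c0(2) by (simp add: w'_def sum_subtractf flip: sum_distrib_left)
    moreover have "(\<Sum>x\<in>A. w' x *\<^sub>R x) = p"
      using w(3) c0(1) by (simp add: w'_def scaleR_diff_left sum_subtractf flip: scaleR_scaleR scaleR_sum_right)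
    ultimately have "sum w' (A - {a1}) = 1" "(\<Sum>x\<in>A - {a1}. w' x *\<^sub>R x) = p"
      using w'1 finA a1(1) by (simp_all add: sum.remove)
    then have "p \<in> convex hull (A - {a1})"
      using w'0 finA by (auto simp: convex_hull_finite intro!: exI[of _ w'])
    then have "card A \<le> card (A - {a1})" using Amin[of "A - {a1}"] A(1) by blast
    moreover have "card (A - {a1}) < card A" using finA a1(1) by (rule card_Diff1_less)
    ultimately show False by simp
  qed
  then show ?thesis using A by blast
qed

text \<open>One point is chosen for each pair of intersecting hulls of sets with at most
  \<open>k\<close> points. If the hulls of \<open>X\<close> and \<open>Y\<close> meet,
  Caratheodory's theorem gives such a pair inside \<open>X\<close> and \<open>Y\<close>, and its
  chosen point lies in both hulls.\<close>

lemma intersection_witnesses: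
  fixes U :: "'a::real_vector set"
  assumes U: "finite U" and B: "finite B" "card B \<le> k" "(\<lambda>x. (x, 1::real)) ` U \<subseteq> span B"
  shows "\<exists>V. finite V \<and> card V \<le> ((card U + 1) ^ k) ^ 2 \<and> V \<subseteq> convex hull U \<and>
    (\<forall>X\<subseteq>U. \<forall>Y\<subseteq>U. convex hull X \<inter> convex hull Y \<noteq> {} \<longrightarrow> V \<inter> convex hull X \<inter> convex hull Y \<noteq> {})"
proof -
  define P where "P = {A. A \<subseteq> U \<and> card A \<le> k}"
  define Q where "Q = {(A, A'). A \<in> P \<and> A' \<in> P \<and> convex hull A \<inter> convex hull A' \<noteq> {}}"
  define z where "z = (\<lambda>(A, A'). SOME p::'a. p \<in> convex hull A \<inter> convex hull A')"
  have zQ: "z (A, A') \<in> convex hull A \<inter> convex hull A'" if "(A, A') \<in> Q" for A A'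
    unfolding z_def prod.case some_in_eq using that by (simp add: Q_def)
  have finP: "finite P" using U by (simp add: P_def)
  have QP: "Q \<subseteq> P \<times> P" by (auto simp: Q_def)
  have finQ: "finite Q" using QP finP finite_subset[of Q "P \<times> P"] by simp
  have "card (z ` Q) \<le> card Q" by (rule card_image_le[OF finQ])
  also have "\<dots> \<le> card (P \<times> P)" by (rule card_mono[OF _ QP]) (use finP in simp)
  also have "\<dots> \<le> (card U + 1) ^ k * (card U + 1) ^ k"
    using bounded_subsets[OF U, of k] by (simp add: card_cartesian_product P_def mult_le_mono)
  finally have card: "card (z ` Q) \<le> ((card U + 1) ^ k) ^ 2" by (simp only: power2_eq_square)
  have sub: "z ` Q \<subseteq> convex hull U"
  proof
    fix p assume "p \<in> z ` Q"
    then obtain A A' where A: "(A, A') \<in> Q" "p = z (A, A')" by auto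
    then have "A \<subseteq> U" by (auto simp: Q_def P_def)
    then show "p \<in> convex hull U" using zQ[OF A(1)] A(2) hull_mono[of A U] by blast
  qed
  have hit: "z ` Q \<inter> convex hull X \<inter> convex hull Y \<noteq> {}"
    if XY: "X \<subseteq> U" "Y \<subseteq> U" "convex hull X \<inter> convex hull Y \<noteq> {}" for X Y
  proof -
    obtain p where p: "p \<in> convex hull X" "p \<in> convex hull Y" using XY(3) by blast
    have fin: "finite X" "finite Y" using XY(1,2) U finite_subset by blast+
    have sp: "(\<lambda>x. (x, 1::real)) ` X \<subseteq> span B" "(\<lambda>x. (x, 1::real)) ` Y \<subseteq> span B"
      using XY(1,2) B(3) by blast+
    obtain A where A: "A \<subseteq> X" "card A \<le> k" "p \<in> convex hull A"
      using caratheodory_lifted[OF fin(1) B(1,2) sp(1) p(1)] by blast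
    obtain A' where A': "A' \<subseteq> Y" "card A' \<le> k" "p \<in> convex hull A'"
      using caratheodory_lifted[OF fin(2) B(1,2) sp(2) p(2)] by blast
    have Q: "(A, A') \<in> Q" using A A' XY(1,2) by (auto simp: Q_def P_def)
    have "z (A, A') \<in> convex hull X \<inter> convex hull Y"
      using zQ[OF Q] hull_mono[OF A(1), of convex] hull_mono[OF A'(1), of convex] by blast
    then show ?thesis using Q by blast
  qed
  show ?thesis using finQ card sub hit by (intro exI[of _ "z ` Q"]) simp
qed

section \<open>The protocol\<close>

lemma split_bounded_set:
  assumes "finite F" "card F \<le> 2 ^ Suc b"
  obtains F1 F2 where "F = F1 \<union> F2" "F1 \<inter> F2 = {}" "finite F1" "finite F2" "card F1 \<le> 2 ^ b" "card F2 \<le> 2 ^ b"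
proof (cases "card F \<le> 2 ^ b")
  case True
  then show ?thesis using that[of F "{}"] assms(1) by simp
next
  case False
  then obtain T where T: "T \<subseteq> F" "card T = 2 ^ b" "finite T"
    using obtain_subset_with_card_n[of "2 ^ b" F] by auto
  have "card (F - T) \<le> 2 ^ b" using assms T by (simp add: card_Diff_subset)
  then show ?thesis using that[of T "F - T"] T assms(1) by auto
qed

text \<open>Each bit tells which half of the remaining range contains the message. The parameters
  \<open>speak\<close> and \<open>inp\<close> stand for the speaking player and that player's input,
  so one proof serves both players.\<close>

lemma send_message:
  fixes P :: "'c \<Rightarrow> ('a, 'b, 'o) protocol" and inp :: "'a \<Rightarrow> 'b \<Rightarrow> 'i" and g :: "'i \<Rightarrow> 'c"
    and speak :: "('i \<Rightarrow> bool) \<Rightarrow> ('a, 'b, 'o) protocol \<Rightarrow> ('a, 'b, 'o) protocol \<Rightarrow> ('a, 'b, 'o) protocol"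
  assumes cost: "\<And>h p q. protocol_cost (speak h p q) = Suc (max (protocol_cost p) (protocol_cost q))"
    and run: "\<And>h p q x y. run_protocol (speak h p q) x y =
      (if h (inp x y) then run_protocol p x y else run_protocol q x y)"
    and "finite F" "card F \<le> 2 ^ b" "\<And>c. c \<in> F \<Longrightarrow> protocol_cost (P c) \<le> K"
  shows "\<exists>p. protocol_cost p \<le> b + K \<and> (\<forall>x y. g (inp x y) \<in> F \<longrightarrow> run_protocol p x y = run_protocol (P (g (inp x y))) x y)"
  using assms(3-5)
proof (induction b arbitrary: F)
  case 0
  show ?case
  proof (cases "F = {}")
    case True
    \<comment> \<open>No message lies in the empty range, so any output will do.\<close>
    then show ?thesis by (intro exI[of _ "Output undefined"]) simp
  next
    case False
    then have "card F = 1" using 0 by (simp add: le_Suc_eq)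
    then obtain c where "F = {c}" using card_1_singletonE by blast
    then show ?thesis using 0(3) by (intro exI[of _ "P c"]) auto
  qed
next
  case (Suc b F)
  obtain F1 F2 where F: "F = F1 \<union> F2" "F1 \<inter> F2 = {}" "finite F1" "finite F2" "card F1 \<le> 2 ^ b" "card F2 \<le> 2 ^ b"
    using split_bounded_set[OF Suc.prems(1,2)] by blast
  obtain p1 where p1: "protocol_cost p1 \<le> b + K"
      "\<forall>x y. g (inp x y) \<in> F1 \<longrightarrow> run_protocol p1 x y = run_protocol (P (g (inp x y))) x y"
    using Suc.IH[OF F(3,5)] Suc.prems(3) F(1) by auto
  obtain p2 where p2: "protocol_cost p2 \<le> b + K"
      "\<forall>x y. g (inp x y) \<in> F2 \<longrightarrow> run_protocol p2 x y = run_protocol (P (g (inp x y))) x y"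
    using Suc.IH[OF F(4,6)] Suc.prems(3) F(1) by auto
  show ?case using p1 p2 F(1)
    by (intro exI[of _ "speak (\<lambda>i. g i \<in> F1) p1 p2"]) (auto simp: cost run)
qed

section \<open>Lifting to height one and light halfspaces\<close>

lemma convex_hull_lift:
  fixes X :: "'a::real_vector set"
  assumes "v \<in> convex hull X"
  shows "(v, 1::real) \<in> convex hull ((\<lambda>x. (x, 1)) ` X)"
proof -
  let ?S = "(\<lambda>x. (x, 1::real)) ` X"
  have "convex hull X \<subseteq> {v. (v, 1) \<in> convex hull ?S}"
  proof (rule hull_minimal)
    show "X \<subseteq> {v. (v, 1) \<in> convex hull ?S}" by (auto intro: hull_inc)
    show "convex {v. (v, 1) \<in> convex hull ?S}"
    proof (rule convexI)
      fix x y and s t :: real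
      assume xy: "x \<in> {v. (v, 1) \<in> convex hull ?S}" "y \<in> {v. (v, 1) \<in> convex hull ?S}" "0 \<le> s" "0 \<le> t" "s + t = 1"
      have "s *\<^sub>R (x, 1) + t *\<^sub>R (y, 1) \<in> convex hull ?S"
        using xy by (intro convexD[OF convex_convex_hull]) auto
      then show "s *\<^sub>R x + t *\<^sub>R y \<in> {v. (v, 1) \<in> convex hull ?S}" using xy(5) by simp
    qed
  qed
  then show ?thesis using assms by blast
qed

lemma convex_hull_lift_in_span:
  fixes U :: "'a::real_vector set"
  assumes "(\<lambda>x. (x, 1::real)) ` U \<subseteq> span B" "V \<subseteq> convex hull U"
  shows "(\<lambda>x. (x, 1::real)) ` V \<subseteq> span B"
proof -
  have "convex hull ((\<lambda>x. (x, 1::real)) ` U) \<subseteq> span B"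
    by (rule hull_minimal[of _ _ convex]) (use assms(1) in \<open>auto intro: subspace_imp_convex\<close>)
  then show ?thesis using convex_hull_lift[of _ U] assms(2) by blast
qed

text \<open>A linear functional on the lifted space is an affine one below. Whether some
  \<open>f\<close> qualifies depends only on \<open>V\<close>, which both players know, and on the
  player's own set.\<close>

definition light_halfspace :: "'a::real_vector set \<Rightarrow> 'a set \<Rightarrow> ('a \<times> real \<Rightarrow> real) \<Rightarrow> bool" where
  "light_halfspace V X f \<longleftrightarrow> linear f \<and> (\<forall>x\<in>X. f (x, 1) > 0) \<and> 2 * card {v\<in>V. f (v, 1) > 0} \<le> card V"

text \<open>A light halfspace holds at most half of \<open>V\<close> and its container exceeds it by
  at most a quarter, which gives three quarters. The halfspace includes the whole hull of
  \<open>X\<close>, so no witness in that hull is lost.\<close>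

lemma light_halfspace_container:
  fixes V :: "'a::real_vector set"
  assumes V: "finite V" and k: "k \<ge> 1" "finite B" "card B \<le> k" "(\<lambda>x. (x, 1::real)) ` V \<subseteq> span B"
  shows "\<exists>F. finite F \<and> card F \<le> ((128 * k ^ 4) ^ k) ^ 2 * 2 ^ k \<and>
    (\<forall>c\<in>F. c \<subseteq> V \<and> 4 * card c \<le> 3 * card V) \<and>
    (\<forall>X f. light_halfspace V X f \<longrightarrow> (\<exists>c\<in>F. V \<inter> convex hull X \<subseteq> c))"
proof -
  let ?L = "\<lambda>x::'a. (x, 1::real)"
  have inj: "inj_on ?L A" for A by (auto simp: inj_on_def)
  obtain F where F: "finite F" "card F \<le> ((128 * k ^ 4) ^ k) ^ 2 * 2 ^ k"
    "\<forall>f::'a \<times> real \<Rightarrow> real. linear f \<longrightarrow> (\<exists>c\<in>F. {v\<in>?L ` V. f v > 0} \<subseteq> c \<and> c \<subseteq> ?L ` V \<and>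
       4 * card c \<le> 4 * card {v\<in>?L ` V. f v > 0} + card (?L ` V))"
    using halfspace_containers[OF finite_imageI[OF V] k(1,2,3,4)] by (elim exE conjE)
  \<comment> \<open>Containers of heavier halfspaces may be large; discarding them makes the size
    bound hold throughout the family.\<close>
  define G where "G = {c \<in> (\<lambda>c. {v\<in>V. ?L v \<in> c}) ` F. 4 * card c \<le> 3 * card V}"
  have "card G \<le> card ((\<lambda>c. {v\<in>V. ?L v \<in> c}) ` F)"
    unfolding G_def by (rule card_mono) (use F(1) in auto)
  also have "\<dots> \<le> card F" by (rule card_image_le[OF F(1)])
  finally have cardG: "card G \<le> ((128 * k ^ 4) ^ k) ^ 2 * 2 ^ k" using F(2) by linarith
  have "\<exists>c\<in>G. V \<inter> convex hull X \<subseteq> c" if f: "light_halfspace V X f" for X f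
  proof -
    have linf: "linear f" using f by (simp add: light_halfspace_def)
    obtain c where c: "c \<in> F" "{v\<in>?L ` V. f v > 0} \<subseteq> c" "c \<subseteq> ?L ` V"
       "4 * card c \<le> 4 * card {v\<in>?L ` V. f v > 0} + card (?L ` V)"
      using F(3)[rule_format, OF linf] by (elim bexE conjE)
    define c' where "c' = {v\<in>V. ?L v \<in> c}"
    have "?L ` c' = c" using c(3) by (auto simp: c'_def)
    then have "card c = card c'" using card_image[OF inj, of c'] by simp
    moreover have "{v\<in>?L ` V. f v > 0} = ?L ` {v\<in>V. f (v, 1) > 0}" by auto
    then have "card {v\<in>?L ` V. f v > 0} = card {v\<in>V. f (v, 1) > 0}" using card_image[OF inj] by simp
    moreover have "card (?L ` V) = card V" by (rule card_image[OF inj])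
    ultimately have "4 * card c' \<le> 3 * card V" using c(4) f by (simp add: light_halfspace_def)
    then have "c' \<in> G" using c(1) by (simp add: G_def c'_def)
    moreover have "V \<inter> convex hull X \<subseteq> c'"
    proof
      fix v assume v: "v \<in> V \<inter> convex hull X"
      have "f (v, 1) > 0"
        by (rule linear_pos_on_convex_hull[OF linf _ convex_hull_lift[of v X]])
          (use v f in \<open>auto simp: light_halfspace_def\<close>)
      then show "v \<in> c'" using v c(2) by (auto simp: c'_def)
    qed
    ultimately show ?thesis by blast
  qed
  moreover have "finite G" using F(1) by (simp add: G_def)
  moreover have "\<forall>c\<in>G. c \<subseteq> V \<and> 4 * card c \<le> 3 * card V" by (auto simp: G_def)
  ultimately show ?thesis using cardG by (intro exI[of _ G]) simp
qed

text \<open>One of the two sides of a separating hyperplane contains at most half of \<open>V\<close>.\<close>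

lemma light_halfspace_of_disjoint:
  fixes X Y V :: "'a::real_vector set"
  assumes "finite X" "finite Y" "finite V" "convex hull X \<inter> convex hull Y = {}"
  shows "(\<exists>f. light_halfspace V X f) \<or> (\<exists>f. light_halfspace V Y f)"
proof -
  obtain f :: "'a \<times> real \<Rightarrow> real" where f: "linear f" "\<forall>x\<in>X. f (x, 1) > 0" "\<forall>y\<in>Y. f (y, 1) < 0"
    using separating_functional[OF assms(1,2,4)] by (elim exE conjE)
  have lneg: "linear (\<lambda>v. - f v)" using linear_compose_neg[OF f(1)] .
  let ?P = "{v\<in>V. f (v, 1) > 0}" and ?M = "{v\<in>V. - f (v, 1) > 0}"
  have "card ?P + card ?M = card (?P \<union> ?M)"
    by (rule card_Un_disjoint[symmetric]) (use assms(3) in auto)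
  also have "\<dots> \<le> card V" by (rule card_mono[OF assms(3)]) auto
  finally consider "2 * card ?P \<le> card V" | "2 * card ?M \<le> card V" by linarith
  then show ?thesis
  proof cases
    case 1
    then have "light_halfspace V X f" using f by (simp add: light_halfspace_def)
    then show ?thesis by blast
  next
    case 2
    then have "light_halfspace V Y (\<lambda>v. - f v)" using f(3) lneg by (simp add: light_halfspace_def)
    then show ?thesis by (intro disjI2 exI)
  qed
qed

text \<open>Induction on the number of rounds, with the invariant that \<open>V\<close> contains all
  witnesses common to both hulls and has fewer than \<open>(4/3)^s\<close> elements. For
  \<open>s = 0\<close> it is empty, so the answer is 1. A round costs at most two bits to find a
  player with a light halfspace and \<open>b\<close> bits for the container.\<close>

lemma protocol_from_witnesses:
  fixes U V0 :: "'a::real_vector set"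
  assumes U: "finite U" and k: "k \<ge> 1" "finite B" "card B \<le> k" "(\<lambda>x. (x, 1::real)) ` U \<subseteq> span B"
    and b: "((128 * k ^ 4) ^ k) ^ 2 * 2 ^ k \<le> (2::nat) ^ b"
    and V0: "finite V0" "V0 \<subseteq> convex hull U"
      "\<And>X Y. X \<subseteq> U \<Longrightarrow> Y \<subseteq> U \<Longrightarrow> convex hull X \<inter> convex hull Y \<noteq> {} \<Longrightarrow>
        V0 \<inter> convex hull X \<inter> convex hull Y \<noteq> {}"
    and V: "V \<subseteq> V0" "card V * 3 ^ s < 4 ^ s"
  shows "\<exists>p. protocol_cost p \<le> s * (b + 2) \<and>
    (\<forall>X\<subseteq>U. \<forall>Y\<subseteq>U. V0 \<inter> convex hull X \<inter> convex hull Y \<subseteq> V \<longrightarrow>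
      run_protocol p X Y = convex_set_disjointness X Y)"
  using V
proof (induction s arbitrary: V)
  case (0 V)
  then have "V = {}" using V0(1) finite_subset[of V V0] by simp
  then have "convex_set_disjointness X Y = 1"
    if "X \<subseteq> U" "Y \<subseteq> U" "V0 \<inter> convex hull X \<inter> convex hull Y \<subseteq> V" for X Y
    using V0(3)[OF that(1,2)] that(3) by (auto simp: convex_set_disjointness_def)
  then show ?case by (intro exI[of _ "Output 1"]) simp
next
  case (Suc s V)
  have finV: "finite V" using Suc.prems(1) V0(1) finite_subset by blast
  have spV: "(\<lambda>x. (x, 1::real)) ` V \<subseteq> span B"
    by (rule convex_hull_lift_in_span[OF k(4)]) (use Suc.prems(1) V0(2) in blast)
  obtain F where F: "finite F" "card F \<le> ((128 * k ^ 4) ^ k) ^ 2 * 2 ^ k"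
    "\<forall>c\<in>F. c \<subseteq> V \<and> 4 * card c \<le> 3 * card V"
    "\<forall>X f. light_halfspace V X f \<longrightarrow> (\<exists>c\<in>F. V \<inter> convex hull X \<subseteq> c)"
    using light_halfspace_container[OF finV k(1,2,3) spV] by (elim exE conjE)
  have cardF: "card F \<le> 2 ^ b" using F(2) b by linarith
  define good where "good = (\<lambda>c p. protocol_cost p \<le> s * (b + 2) \<and>
    (\<forall>X\<subseteq>U. \<forall>Y\<subseteq>U. V0 \<inter> convex hull X \<inter> convex hull Y \<subseteq> c \<longrightarrow>
      run_protocol p X Y = convex_set_disjointness X Y))"
  have "\<exists>p. good c p" if "c \<in> F" for c
  proof -
    have c: "c \<subseteq> V0" "4 * card c \<le> 3 * card V" using F(3) that Suc.prems(1) by blast+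
    \<comment> \<open>Shrinking to three quarters passes from the bound \<open>(4/3)^(s+1)\<close>
      to \<open>(4/3)^s\<close>.\<close>
    have "4 * (card c * 3 ^ s) \<le> card V * 3 ^ Suc s" using mult_le_mono1[OF c(2), of "3 ^ s"] by simp
    also have "\<dots> < 4 * 4 ^ s" using Suc.prems(2) by simp
    finally have "card c * 3 ^ s < 4 ^ s" by simp
    then show ?thesis unfolding good_def by (rule Suc.IH[OF c(1)])
  qed
  then have "\<exists>P. \<forall>c\<in>F. good c (P c)" by (rule bchoice[OF ballI])
  then obtain P where P: "\<forall>c\<in>F. good c (P c)" by (rule exE)
  then have costP: "protocol_cost (P c) \<le> s * (b + 2)" if "c \<in> F" for c
    using P that by (simp add: good_def)
  define light where "light = (\<lambda>X. \<exists>f. light_halfspace V X f)"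
  define g where "g = (\<lambda>X. SOME c. c \<in> F \<and> V \<inter> convex hull X \<subseteq> c)"
  have g: "g X \<in> F" "V \<inter> convex hull X \<subseteq> g X" if X: "light X" for X
  proof -
    have "\<exists>c. c \<in> F \<and> V \<inter> convex hull X \<subseteq> c" using F(4) X unfolding light_def by blast
    then have "g X \<in> F \<and> V \<inter> convex hull X \<subseteq> g X" unfolding g_def by (rule someI_ex)
    then show "g X \<in> F" "V \<inter> convex hull X \<subseteq> g X" by blast+
  qed
  obtain pA where pA: "protocol_cost pA \<le> b + s * (b + 2)"
      "\<forall>X Y. g X \<in> F \<longrightarrow> run_protocol pA X Y = run_protocol (P (g X)) X Y"
    using send_message[where speak = Alice_Speaks and inp = "\<lambda>x y. x" and g = g and P = P, OF _ _ F(1) cardF costP]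
    by auto
  obtain pB where pB: "protocol_cost pB \<le> b + s * (b + 2)"
      "\<forall>X Y. g Y \<in> F \<longrightarrow> run_protocol pB X Y = run_protocol (P (g Y)) X Y"
    using send_message[where speak = Bob_Speaks and inp = "\<lambda>x y. y" and g = g and P = P, OF _ _ F(1) cardF costP]
    by auto
  \<comment> \<open>Bob is asked only if Alice has no light halfspace. If neither has one, the hulls
    cannot be disjoint, and the output is 0.\<close>
  define p where "p = Alice_Speaks light pA (Bob_Speaks light pB (Output 0))"
  have "run_protocol p X Y = convex_set_disjointness X Y"
    if XY: "X \<subseteq> U" "Y \<subseteq> U" "V0 \<inter> convex hull X \<inter> convex hull Y \<subseteq> V" for X Y
  proof -
    have correct: "run_protocol (P c) X Y = convex_set_disjointness X Y"
      if "c \<in> F" "V0 \<inter> convex hull X \<inter> convex hull Y \<subseteq> c" for c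
      using P that XY(1,2) by (simp add: good_def)
    consider "light X" | "\<not> light X" "light Y" | "\<not> light X" "\<not> light Y" by blast
    then show ?thesis
    proof cases
      case 1
      have "V0 \<inter> convex hull X \<inter> convex hull Y \<subseteq> g X" using g(2)[OF 1] XY(3) by blast
      then show ?thesis using 1 pA(2) g(1)[OF 1] correct by (simp add: p_def)
    next
      case 2
      have "V0 \<inter> convex hull X \<inter> convex hull Y \<subseteq> g Y" using g(2)[OF 2(2)] XY(3) by blast
      then show ?thesis using 2 pB(2) g(1)[OF 2(2)] correct by (simp add: p_def)
    next
      case 3
      have "finite X" "finite Y" using XY U finite_subset by blast+
      then have "convex hull X \<inter> convex hull Y \<noteq> {}"
        using light_halfspace_of_disjoint[OF _ _ finV, of X Y] 3 unfolding light_def by blast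
      then show ?thesis using 3 by (simp add: p_def convex_set_disjointness_def)
    qed
  qed
  moreover have "protocol_cost p \<le> Suc s * (b + 2)" using pA(1) pB(1) by (simp add: p_def)
  ultimately show ?case by (intro exI[of _ p]) simp
qed

text \<open>There are at most \<open>2 ^ (2 * k * q)\<close> witnesses, and \<open>3 * j\<close>
  rounds dispose of them. A container is named by
  \<open>2 * k * (7 + 4 * l) + k = k * (15 + 8 * l)\<close> bits.\<close>

lemma csd_complexity_le:
  fixes U :: "'a::real_vector set"
  assumes U: "finite U" and k: "k \<ge> 1" "finite B" "card B \<le> k" "(\<lambda>x. (x, 1::real)) ` U \<subseteq> span B"
    and l: "k \<le> 2 ^ l" and q: "card U + 1 \<le> 2 ^ q"
  shows "csd_complexity U \<le> enat (3 * (2 * k * q + 1) * (k * (15 + 8 * l) + 2))"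
proof -
  obtain V where V: "finite V" "card V \<le> ((card U + 1) ^ k) ^ 2" "V \<subseteq> convex hull U"
    "\<forall>X\<subseteq>U. \<forall>Y\<subseteq>U. convex hull X \<inter> convex hull Y \<noteq> {} \<longrightarrow> V \<inter> convex hull X \<inter> convex hull Y \<noteq> {}"
    using intersection_witnesses[OF U k(2-4)] by (elim exE conjE)
  define b where "b = k * (15 + 8 * l)"
  define j where "j = 2 * k * q + 1"
  have "128 * k ^ 4 \<le> 2 ^ 7 * (2 ^ l) ^ 4" using l by (intro mult_le_mono power_mono) auto
  also have "\<dots> = (2::nat) ^ (7 + 4 * l)" by (simp add: power_add power_mult[symmetric] mult.commute)
  finally have "((128 * k ^ 4) ^ k) ^ 2 * 2 ^ k \<le> (((2::nat) ^ (7 + 4 * l)) ^ k) ^ 2 * 2 ^ k"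
    by (intro mult_le_mono1 power_mono) auto
  also have "\<dots> = 2 ^ ((7 + 4 * l) * k * 2 + k)" by (simp only: power_mult power_add)
  also have "(7 + 4 * l) * k * 2 + k = b" by (simp add: b_def algebra_simps)
  finally have b: "((128 * k ^ 4) ^ k) ^ 2 * 2 ^ k \<le> (2::nat) ^ b" .
  have "card V \<le> ((2 ^ q) ^ k) ^ 2"
    by (rule order_trans[OF V(2)]) (intro power_mono q; simp)
  also have "((2::nat) ^ q) ^ k = 2 ^ (q * k)" by (simp only: power_mult)
  also have "(2 ^ (q * k)) ^ 2 = (2::nat) ^ (q * k * 2)" by (simp only: power_mult)
  also have "q * k * 2 = 2 * k * q" by simp
  also have "(2::nat) ^ (2 * k * q) < 2 ^ j" by (simp add: j_def)
  \<comment> \<open>Three rounds at least halve the witnesses, as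
    \<open>2 * 27 \<le> 64\<close>.\<close>
  finally have "card V * 27 ^ j < 2 ^ j * 27 ^ j" by simp
  also have "\<dots> = (2 * 27) ^ j" by (simp only: power_mult_distrib)
  also have "\<dots> \<le> (64::nat) ^ j" by (rule power_mono) auto
  finally have "card V * 3 ^ (3 * j) < 4 ^ (3 * j)" by (simp add: power_mult)
  then have "\<exists>p. protocol_cost p \<le> 3 * j * (b + 2) \<and>
    (\<forall>X\<subseteq>U. \<forall>Y\<subseteq>U. V \<inter> convex hull X \<inter> convex hull Y \<subseteq> V \<longrightarrow>
      run_protocol p X Y = convex_set_disjointness X Y)"
    using V(4) by (intro protocol_from_witnesses[OF U k b V(1,3) _ order_refl]) simp_all
  then obtain p where p: "protocol_cost p \<le> 3 * j * (b + 2)"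
    "\<forall>X\<subseteq>U. \<forall>Y\<subseteq>U. V \<inter> convex hull X \<inter> convex hull Y \<subseteq> V \<longrightarrow>
      run_protocol p X Y = convex_set_disjointness X Y"
    by (elim exE conjE)
  then have correct: "\<forall>X\<subseteq>U. \<forall>Y\<subseteq>U. run_protocol p X Y = convex_set_disjointness X Y" by auto
  have "csd_complexity U \<le> enat (protocol_cost p)"
    unfolding csd_complexity_def det_comm_complexity_def
    by (rule INF_lower) (use correct in \<open>simp add: protocol_computes_def\<close>)
  also have "\<dots> \<le> enat (3 * j * (b + 2))" using p(1) by simp
  finally show ?thesis by (simp only: j_def b_def)
qed

section \<open>Coordinates of d-space and the final constants\<close>

lemma lookup_scaleR:
  fixes x :: "'a \<Rightarrow>\<^sub>0 real"
  shows "Poly_Mapping.lookup (r *\<^sub>R x) i = r * Poly_Mapping.lookup x i"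
proof -
  have "finite {i. r *\<^sub>R Poly_Mapping.lookup x i \<noteq> 0}"
    by (rule finite_subset[OF _ finite_keys[of x]]) (auto simp: in_keys_iff)
  then show ?thesis by (simp add: scaleR_poly_mapping_def Abs_poly_mapping_inverse)
qed

text \<open>The unit vectors at height 0 together with the point \<open>(0, 1)\<close> span the
  lift, so \<open>k = d + 1\<close> is admissible.\<close>

lemma real_space_lift_in_span:
  "\<exists>B. finite B \<and> card B \<le> d + 1 \<and> (\<lambda>x. (x, 1::real)) ` real_space d \<subseteq> span B"
proof -
  define e where "e = (\<lambda>i::nat. (Poly_Mapping.single i (1::real), 0::real))"
  define B where "B = insert (0, 1) (e ` {..<d})"
  have "card (e ` {..<d}) \<le> d" using card_image_le[of "{..<d}" e] by simp
  then have "card B \<le> d + 1" unfolding B_def by (intro card_insert_le_m1) auto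
  moreover have "(x, 1) \<in> span B" if x: "x \<in> real_space d" for x
  proof -
    have "x = (\<Sum>i<d. Poly_Mapping.lookup x i *\<^sub>R Poly_Mapping.single i 1)"
    proof (rule poly_mapping_eqI)
      fix j
      have "Poly_Mapping.lookup x j = 0" if "\<not> j < d"
        using x that by (auto simp: real_space_def in_keys_iff)
      then show "Poly_Mapping.lookup x j =
          Poly_Mapping.lookup (\<Sum>i<d. Poly_Mapping.lookup x i *\<^sub>R Poly_Mapping.single i 1) j"
        by (simp add: lookup_sum lookup_single when_def lookup_scaleR if_distrib sum.delta cong: if_cong)
    qed
    then have "(x, 1) = (\<Sum>i<d. Poly_Mapping.lookup x i *\<^sub>R e i) + (0, 1)"
      by (simp add: e_def prod_eq_iff fst_sum snd_sum)
    also have "\<dots> \<in> span B"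
      by (intro span_add span_sum span_scale span_base) (auto simp: B_def)
    finally show ?thesis .
  qed
  ultimately show ?thesis by (intro exI[of _ B]) (auto simp: B_def)
qed

lemma power_two_upper_bound:
  fixes m :: nat
  assumes "m \<ge> 1"
  shows "\<exists>l. m \<le> 2 ^ l \<and> real l \<le> log 2 m + 1"
proof -
  define l where "l = nat \<lceil>log 2 (real m)\<rceil>"
  have l0: "0 \<le> log 2 (real m)" using assms by simp
  have "real m = 2 powr (log 2 (real m))" using assms by simp
  also have "\<dots> \<le> 2 powr (real l)" by (intro powr_mono) (auto simp: l_def real_nat_ceiling_ge)
  also have "\<dots> = 2 ^ l" by (simp add: powr_realpow)
  finally have "real m \<le> real (2 ^ l)" by simp
  then have "m \<le> 2 ^ l" by (simp only: of_nat_le_iff)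
  moreover have "real l \<le> log 2 m + 1" using l0 by (simp add: l_def)
  ultimately show ?thesis by blast
qed

lemma log_add_one_le:
  assumes "m \<ge> 1"
  shows "log 2 (real (m + 1)) \<le> 2 * log_ge1 m"
proof -
  have "log 2 (real (m + 1)) \<le> log 2 (2 * real m)" using assms by simp
  also have "\<dots> = 1 + log 2 m" using assms by (simp add: log_mult)
  also have "\<dots> \<le> 2 * log_ge1 m" by (simp add: log_ge1_def)
  finally show ?thesis .
qed

theorem mainTheorem3:
  shows "\<exists>C::real. C > 0 \<and>
    (\<forall>(d::nat) (n::nat) (U::(nat \<Rightarrow>\<^sub>0 real) set).
       d \<ge> 1 \<longrightarrow> n \<ge> 1 \<longrightarrow> U \<subseteq> real_space d \<longrightarrow> finite U \<longrightarrow> card U = n \<longrightarrow>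
       ereal_of_enat (csd_complexity U) \<le> ereal (C * (real d)\<^sup>2 * log_ge1 d * log_ge1 n))"
proof (intro exI[of _ 3120] conjI allI impI)
  fix d n :: nat and U :: "(nat \<Rightarrow>\<^sub>0 real) set"
  assume d: "d \<ge> 1" and n: "n \<ge> 1" and U: "U \<subseteq> real_space d" "finite U" "card U = n"
  obtain B where B: "finite B" "card B \<le> d + 1" "(\<lambda>x. (x, 1::real)) ` real_space d \<subseteq> span B"
    using real_space_lift_in_span[of d] by (elim exE conjE)
  have UB: "(\<lambda>x. (x, 1::real)) ` U \<subseteq> span B" using B(3) U(1) by blast
  obtain l where l: "d + 1 \<le> 2 ^ l" "real l \<le> log 2 (real (d + 1)) + 1"
    using power_two_upper_bound[of "d + 1"] by (metis le_add2)
  obtain q where q: "n + 1 \<le> 2 ^ q" "real q \<le> log 2 (real (n + 1)) + 1"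
    using power_two_upper_bound[of "n + 1"] by (metis le_add2)
  \<comment> \<open>With \<open>k = d + 1\<close>, \<open>s\<close> is the number of rounds and
    \<open>b\<close> the cost of one round.\<close>
  define b where "b = (d + 1) * (15 + 8 * l) + 2"
  define s where "s = 3 * (2 * (d + 1) * q + 1)"
  have le: "csd_complexity U \<le> enat (s * b)"
    using csd_complexity_le[OF U(2) _ B(1,2) UB l(1), of q] q(1) U(3) by (simp add: s_def b_def)
  define LD where "LD = log_ge1 d"
  define LN where "LN = log_ge1 n"
  have L1: "LD \<ge> 1" "LN \<ge> 1" by (simp_all add: LD_def LN_def log_ge1_def)
  \<comment> \<open>\<open>log 2 (d + 1) + 1 \<le> 2 * LD + 1 \<le> 3 * LD\<close>, and likewise for
    \<open>n\<close>.\<close>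
  have lq: "real l \<le> 3 * LD" "real q \<le> 3 * LN"
    using l(2) q(2) log_add_one_le[OF d] log_add_one_le[OF n] L1 unfolding LD_def LN_def by linarith+
  have D1: "real d \<ge> 1" using d by simp
  have dLD: "1 \<le> real d * LD" "1 \<le> real d * LN" using D1 L1 mult_mono[of 1 "real d" 1] by auto
  \<comment> \<open>\<open>d + 1 \<le> 2 * d\<close> and \<open>15 + 8 * 3 = 39\<close> give
    \<open>2 * 39 + 2 = 80\<close>.\<close>
  have "real b = real (d + 1) * (15 + 8 * real l) + 2" by (simp add: b_def algebra_simps)
  also have "\<dots> \<le> 2 * real d * (39 * LD) + 2 * (real d * LD)"
    using dLD lq L1 D1 by (intro add_mono mult_mono) auto
  finally have bb: "real b \<le> 80 * (real d * LD)" by (simp add: mult_ac)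
  \<comment> \<open>Here \<open>3 * (2 * 2 * 3 + 1) = 39\<close>, and the final constant is
    \<open>39 * 80 = 3120\<close>.\<close>
  have "real s = 3 * (2 * real (d + 1) * real q + 1)" by (simp add: s_def algebra_simps)
  also have "\<dots> \<le> 3 * (2 * (2 * real d) * (3 * LN) + real d * LN)"
    using dLD lq L1 D1 by (intro mult_left_mono add_mono mult_mono) auto
  finally have ss: "real s \<le> 39 * (real d * LN)" by (simp add: mult_ac)
  have "real (s * b) \<le> (39 * (real d * LN)) * (80 * (real d * LD))"
    unfolding of_nat_mult using ss bb dLD by (intro mult_mono) auto
  also have "\<dots> = 3120 * (real d)\<^sup>2 * LD * LN" by (simp add: power2_eq_square)
  finally have "real (s * b) \<le> 3120 * (real d)\<^sup>2 * log_ge1 d * log_ge1 n"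
    by (simp only: LD_def LN_def)
  then have bound: "ereal (real (s * b)) \<le> ereal (3120 * (real d)\<^sup>2 * log_ge1 d * log_ge1 n)"
    by (simp only: ereal_less_eq)
  have "ereal_of_enat (csd_complexity U) \<le> ereal_of_enat (enat (s * b))"
    using le by (simp only: ereal_of_enat_le_iff)
  also have "\<dots> = ereal (real (s * b))" by (simp only: ereal_of_enat_simps)
  finally show "ereal_of_enat (csd_complexity U) \<le> ereal (3120 * (real d)\<^sup>2 * log_ge1 d * log_ge1 n)"
    using bound by (rule order_trans)
qed simp

end
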